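(* Fix integers $t\ge 4$ and $r\ge 3$. The family $\mathcal S_{t,r}(n)$ is as follows. If $n-r+1$ is even, then $\mathcal S_{t,r}(n)=\mathcal T^*(r,n)$. If $n-r+1$ is odd, let $T_+(r,n)$ and $T_-(r,n)$ be the graphs obtained by suspending $K_r$ at a vertex in the larger and smaller part of $T_{n-r+1,2}$, respectively; in this case, if $t$ is odd, then $\mathcal S_{t,r}(n)=\{T_-(r,n)\}$, and if $t=2q$ is even, then $$\mathcal S_{t,r}(n)=\begin{cases}\{T_+(r,n)\}, & r\le q+1,\ (t,r)\ne(4,3),\\ \{T_+(r,n),T_-(r,n)\}, & (t,r)=(4,3),\\ \{T_-(r,n)\}, & r\ge q+2.\end{cases}$$
   Context: Graphs are finite and simple, and are considered up to isomorphism. $P_t$ is the path with $t$ vertices, and $K_r$ is the complete graph on $r$ vertices. $\mathcal N(F,G)$ is the number of unlabeled copies of $F$ in $G$, i.e. the number of (not necessarily induced) subgraphs of $G$ isomorphic to $F$. $T_{m,2}$ is the bipartite Turán graph on $m$ vertices: the complete bipartite graph with parts of sizes $\lfloor m/2\rfloor$ and $\lceil m/2\rceil$. Suspending a graph $H$ on a graph $B$ at a vertex $x\in V(B)$ means taking the disjoint union of $B$ and $H$, identifying $x$ with one vertex of $H$, and adding no further edges. $\mathcal T^*(r,n)$ is the family of ($n$-vertex) graphs obtained from $T_{n-r+1,2}$ by suspending a clique $K_r$ (at any vertex of $T_{n-r+1,2}$). For integers $t\ge 4$ and $r\ge 3$, $\mathcal S_{t,r}(n)$ is the subfamily of $\mathcal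 T^*(r,n)$ consisting of the graphs in $\mathcal T^*(r,n)$ with the maximum number $\mathcal N(P_t,\cdot)$ of copies of $P_t$.
   Formalization: When n-r+1 is odd, the description of S_{t,r}(n) is proved only for all sufficiently large n (threshold depending on t and r); without this it is false, e.g. t=5, r=3, n=5, where T_+ has two copies of P_5 and T_- none. *)

theory Defs imports Main
begin

record 'a ugraph =
  verts :: "'a set"
  edges :: "'a set set"

definition simple_graph :: "'a ugraph \<Rightarrow> bool" where
  "simple_graph G \<longleftrightarrow> finite (verts G) \<and>
     edges G \<subseteq> {{u, v} | u v. u \<in> verts G \<and> v \<in> verts G \<and> u \<noteq> v}"

definition isomorphic :: "'a ugraph \<Rightarrow> 'b ugraph \<Rightarrow> bool" where
  "isomorphic G H \<longleftrightarrow> (\<exists>f. bij_betw f (verts G) (verts H) \<and>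
     (\<forall>u\<in>verts G. \<forall>v\<in>verts G. {u, v} \<in> edges G \<longleftrightarrow> {f u, f v} \<in> edges H))"

text \<open>A family of graphs considered up to isomorphism is the quotient of a set of
  concrete graphs by this relation.\<close>

definition iso_rel :: "('a ugraph \<times> 'a ugraph) set" where
  "iso_rel = {(G, H). simple_graph G \<and> simple_graph H \<and> isomorphic G H}"

definition subgraph_of :: "'a ugraph \<Rightarrow> 'a ugraph \<Rightarrow> bool" where
  "subgraph_of H G \<longleftrightarrow> simple_graph H \<and> verts H \<subseteq> verts G \<and> edges H \<subseteq> edges G"

definition num_copies :: "'b ugraph \<Rightarrow> 'a ugraph \<Rightarrow> nat" where
  "num_copies F G = card {H. subgraph_of H G \<and> isomorphic H F}"

definition path_graph :: "nat \<Rightarrow> nat ugraph" where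
  "path_graph t = \<lparr>verts = {..<t}, edges = {{i, Suc i} | i. Suc i < t}\<rparr>"

definition complete_graph :: "nat \<Rightarrow> nat ugraph" where
  "complete_graph r = \<lparr>verts = {..<r}, edges = {{u, v} | u v. u < r \<and> v < r \<and> u \<noteq> v}\<rparr>"

definition small_part :: "nat \<Rightarrow> nat set" where
  "small_part m = {..<m div 2}"

definition large_part :: "nat \<Rightarrow> nat set" where
  "large_part m = {m div 2..<m}"

definition turan2 :: "nat \<Rightarrow> nat ugraph" where
  "turan2 m = \<lparr>verts = small_part m \<union> large_part m,
               edges = {{u, v} | u v. u \<in> small_part m \<and> v \<in> large_part m}\<rparr>"

text \<open>The graph \<open>H\<close> suspended on \<open>B\<close> at \<open>x\<close>: in the disjoint union of \<open>B\<close> and \<open>H\<close>, the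
  vertex \<open>y\<close> of \<open>H\<close> is identified with \<open>x\<close>. The merged vertex is represented by \<open>Inl x\<close>.\<close>

definition suspend :: "'a ugraph \<Rightarrow> 'a \<Rightarrow> 'b ugraph \<Rightarrow> 'b \<Rightarrow> ('a + 'b) ugraph" where
  "suspend B x H y = (let g = (\<lambda>v. if v = y then Inl x else Inr v) in
     \<lparr>verts = Inl ` verts B \<union> g ` verts H,
      edges = (`) Inl ` edges B \<union> (`) g ` edges H\<rparr>)"

text \<open>The order of the Turan graph is written \<open>n + 1 - r\<close> rather than \<open>n - r + 1\<close>, so that
  truncated subtraction yields no graph at all (instead of a wrong one) for \<open>n < r\<close>.\<close>

definition T_star :: "nat \<Rightarrow> nat \<Rightarrow> (nat + nat) ugraph set" where
  "T_star r n = {suspend (turan2 (n + 1 - r)) x (complete_graph r) y | x y.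
     x \<in> verts (turan2 (n + 1 - r)) \<and> y \<in> verts (complete_graph r)}"

definition S_family :: "nat \<Rightarrow> nat \<Rightarrow> nat \<Rightarrow> (nat + nat) ugraph set" where
  "S_family t r n = {G \<in> T_star r n.
     \<forall>H \<in> T_star r n. num_copies (path_graph t) H \<le> num_copies (path_graph t) G}"

text \<open>Up to isomorphism, the following two graphs do not depend on which vertex of the respective
  part, and which vertex of the clique, is chosen. The vertex \<open>n - r\<close> is the last vertex of the
  Turan graph and lies in its larger part; the vertex \<open>0\<close> lies in the smaller part as soon as that
  part is nonempty.\<close>

definition T_plus :: "nat \<Rightarrow> nat \<Rightarrow> (nat + nat) ugraph" where
  "T_plus r n = suspend (turan2 (n + 1 - r)) (n - r) (complete_graph r) 0"

definition T_minus :: "nat \<Rightarrow> nat \<Rightarrow> (nat + nat) ugraph" where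
  "T_minus r n = suspend (turan2 (n + 1 - r)) 0 (complete_graph r) 0"

lemma equiv_iso_rel: "equiv {G :: 'a ugraph. simple_graph G} iso_rel"
proof (rule equivI)
  show "iso_rel \<subseteq> {G :: 'a ugraph. simple_graph G} \<times> {G. simple_graph G}"
    by (auto simp: iso_rel_def)
  show "refl_on {G :: 'a ugraph. simple_graph G} iso_rel"
    by (auto simp: refl_on_def iso_rel_def isomorphic_def intro!: exI[of _ id])
  show "sym (iso_rel :: ('a ugraph \<times> 'a ugraph) set)"
  proof (rule symI)
    fix G H :: "'a ugraph" assume a: "(G, H) \<in> iso_rel"
    then obtain f where f: "bij_betw f (verts G) (verts H)"
      "\<And>u v. u \<in> verts G \<Longrightarrow> v \<in> verts G \<Longrightarrow> {u, v} \<in> edges G \<longleftrightarrow> {f u, f v} \<in> edges H"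
      by (auto simp: iso_rel_def isomorphic_def)
    let ?g = "inv_into (verts G) f"
    have g: "bij_betw ?g (verts H) (verts G)" using f(1) by (rule bij_betw_inv_into)
    have "{u, v} \<in> edges H \<longleftrightarrow> {?g u, ?g v} \<in> edges G" if "u \<in> verts H" "v \<in> verts H" for u v
      using f(2)[of "?g u" "?g v"] that bij_betwE[OF g] bij_betw_inv_into_right[OF f(1)] by auto
    with g have "isomorphic H G" unfolding isomorphic_def by blast
    with a show "(H, G) \<in> iso_rel" by (auto simp: iso_rel_def)
  qed
  show "trans (iso_rel :: ('a ugraph \<times> 'a ugraph) set)"
  proof (rule transI)
    fix G H K :: "'a ugraph" assume a: "(G, H) \<in> iso_rel" "(H, K) \<in> iso_rel"
    then obtain f g where f: "bij_betw f (verts G) (verts H)"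
      "\<And>u v. u \<in> verts G \<Longrightarrow> v \<in> verts G \<Longrightarrow> {u, v} \<in> edges G \<longleftrightarrow> {f u, f v} \<in> edges H"
      and g: "bij_betw g (verts H) (verts K)"
      "\<And>u v. u \<in> verts H \<Longrightarrow> v \<in> verts H \<Longrightarrow> {u, v} \<in> edges H \<longleftrightarrow> {g u, g v} \<in> edges K"
      by (auto simp: iso_rel_def isomorphic_def)
    have "{u, v} \<in> edges G \<longleftrightarrow> {(g \<circ> f) u, (g \<circ> f) v} \<in> edges K"
      if "u \<in> verts G" "v \<in> verts G" for u v
      using f(2)[OF that] g(2)[of "f u" "f v"] that bij_betwE[OF f(1)] by auto
    with bij_betw_trans[OF f(1) g(1)] have "isomorphic G K" unfolding isomorphic_def by blast
    with a show "(G, K) \<in> iso_rel" by (auto simp: iso_rel_def)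
  qed
qed

lemma T_star_simple:
  assumes "G \<in> T_star r n"
  shows "simple_graph G"
proof -
  obtain x y where x: "x \<in> verts (turan2 (n + 1 - r))"
    and G: "G = suspend (turan2 (n + 1 - r)) x (complete_graph r) y"
    using assms by (auto simp: T_star_def)
  let ?g = "\<lambda>v. if v = y then Inl x else Inr v"
  have fin: "finite (verts G)"
    unfolding G by (simp add: suspend_def turan2_def complete_graph_def small_part_def large_part_def)
  let ?B = "turan2 (n + 1 - r)" and ?K = "complete_graph r"
  have V: "verts G = Inl ` verts ?B \<union> ?g ` verts ?K"
    and E: "edges G = (`) Inl ` edges ?B \<union> (`) ?g ` edges ?K"
    unfolding G suspend_def Let_def by simp_all
  have B: "\<exists>u\<in>verts ?B. \<exists>v\<in>verts ?B. u \<noteq> v \<and> e = {u, v}" if e: "e \<in> edges ?B" for e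
  proof -
    obtain u v where uv: "u \<in> small_part (n + 1 - r)" "v \<in> large_part (n + 1 - r)" "e = {u, v}"
      using e unfolding turan2_def ugraph.simps by blast
    from uv(1,2) have "u \<noteq> v" by (auto simp: small_part_def large_part_def)
    moreover from uv(1,2) have "u \<in> verts ?B" "v \<in> verts ?B" by (simp_all add: turan2_def)
    ultimately show ?thesis using uv(3) by blast
  qed
  have K: "\<exists>u\<in>verts ?K. \<exists>v\<in>verts ?K. u \<noteq> v \<and> e = {u, v}" if "e \<in> edges ?K" for e
    using that unfolding complete_graph_def ugraph.simps by blast
  have g: "?g u \<noteq> ?g v" if "u \<noteq> v" for u v using that by auto
  have "\<exists>u v. e = {u, v} \<and> u \<in> verts G \<and> v \<in> verts G \<and> u \<noteq> v" if e: "e \<in> edges G" for e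
  proof -
    from e[unfolded E] show ?thesis
    proof (elim UnE imageE)
      fix e' assume *: "e = Inl ` e'" "e' \<in> edges ?B"
      obtain u v where uv: "u \<in> verts ?B" "v \<in> verts ?B" "u \<noteq> v" "e' = {u, v}"
        using B[OF *(2)] by blast
      have "e = {Inl u, Inl v}" "Inl u \<in> verts G" "Inl v \<in> verts G" "Inl u \<noteq> (Inl v :: nat + nat)"
        using * uv unfolding V by simp_all
      then show ?thesis by blast
    next
      fix e' assume *: "e = ?g ` e'" "e' \<in> edges ?K"
      obtain u v where uv: "u \<in> verts ?K" "v \<in> verts ?K" "u \<noteq> v" "e' = {u, v}"
        using K[OF *(2)] by blast
      have "e = {?g u, ?g v}" unfolding *(1) uv(4) by (simp only: image_insert image_empty)
      moreover have "?g u \<in> verts G" "?g v \<in> verts G"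
        unfolding V by (rule UnI2, rule imageI, rule uv(1), rule UnI2, rule imageI, rule uv(2))
      ultimately show ?thesis using g[OF uv(3)] by (intro exI conjI)
    qed
  qed
  with fin show ?thesis unfolding simple_graph_def by blast
qed

lemma card_verts_T_star:
  assumes "G \<in> T_star r n"
  shows "card (verts G) = n"
proof -
  obtain x y where x: "x \<in> verts (turan2 (n + 1 - r))" and y: "y < r"
    and G: "G = suspend (turan2 (n + 1 - r)) x (complete_graph r) y"
    using assms by (auto simp: T_star_def complete_graph_def)
  have V: "verts (turan2 (n + 1 - r)) = {..<n + 1 - r}"
    by (auto simp: turan2_def small_part_def large_part_def)
  have "verts G = Inl ` {..<n + 1 - r} \<union> (\<lambda>v. if v = y then Inl x else Inr v) ` {..<r}"
    unfolding G suspend_def Let_def by (simp only: V ugraph.simps complete_graph_def)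
  also have "\<dots> = Inl ` {..<n + 1 - r} \<union> Inr ` ({..<r} - {y})"
    using x[unfolded V] y by (auto split: if_splits)
  finally have "verts G = Inl ` {..<n + 1 - r} \<union> Inr ` ({..<r} - {y})" .
  moreover have "card \<dots> = (n + 1 - r) + (r - 1)"
    using y by (subst card_Un_disjoint) (auto simp: card_image)
  moreover have "n + 1 - r > 0" using x V by auto
  ultimately show ?thesis using y by simp
qed

lemma T_plus_in:
  assumes "0 < r" "r \<le> n"
  shows "n - r \<in> large_part (n + 1 - r)" and "T_plus r n \<in> T_star r n"
proof -
  show "n - r \<in> large_part (n + 1 - r)" using assms by (auto simp: large_part_def)
  then have "n - r \<in> verts (turan2 (n + 1 - r))" "0 \<in> verts (complete_graph r)"
    using assms by (simp_all add: turan2_def complete_graph_def)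
  then show "T_plus r n \<in> T_star r n" unfolding T_plus_def T_star_def by blast
qed

lemma T_minus_in:
  assumes "0 < r" "r < n"
  shows "0 \<in> small_part (n + 1 - r)" and "T_minus r n \<in> T_star r n"
proof -
  show "0 \<in> small_part (n + 1 - r)" using assms by (auto simp: small_part_def)
  then have "0 \<in> verts (turan2 (n + 1 - r))" "0 \<in> verts (complete_graph r)"
    using assms by (simp_all add: turan2_def complete_graph_def)
  then show "T_minus r n \<in> T_star r n" unfolding T_minus_def T_star_def by blast
qed

end

theory Submission imports Defs "HOL-Combinatorics.Transposition"
begin

text \<open>Write \<open>m = n + 1 - r\<close>. The Turan graph \<open>T\<close> on \<open>m\<close> vertices and the clique \<open>K\<close> share only the
  vertex \<open>x\<close> of suspension, which is a cut vertex. A copy of \<open>P\<^sub>t\<close> therefore lies in \<open>T\<close>, or lies in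
  \<open>K\<close>, or consists of an arm of \<open>k \<ge> 1\<close> edges from \<open>x\<close> into \<open>K\<close> and an arm of \<open>t - 1 - k \<ge> 1\<close> edges
  from \<open>x\<close> into \<open>T\<close>. The first two numbers do not depend on \<open>x\<close>. The third is a sum over \<open>k\<close> of
  products of falling factorials: there are \<open>(r - 1)\<^sub>k\<close> such arms in \<open>K\<close>, and an arm in \<open>T\<close> alternates
  between the parts, which gives \<open>(a - 1)\<^sub>c (b)\<^sub>d\<close> arms with \<open>c + d\<close> edges, \<open>c \<le> d \<le> c + 1\<close>, where \<open>a\<close> is
  the size of the part of \<open>x\<close> and \<open>b\<close> that of the other part (\<open>num_copies_suspend_turan2\<close>).
  If \<open>m\<close> is even then \<open>a = b\<close>, and all members of the family tie.

  If \<open>m = 2 s + 1\<close>, the question is the sign of the difference between \<open>x\<close> in the small part and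
  \<open>x\<close> in the large part. With \<open>g b = (s)\<^sub>b (s - 1)\<^sub>b\<close>
  (\<open>falling_prod\<close>), a polynomial in \<open>s\<close> of degree \<open>2 b\<close>, the number of
  \<open>j\<close>-edge arms changes by exactly \<open>g b\<close> for \<open>j = 2 b + 1\<close> and by \<open>- b g (b - 1)\<close> for \<open>j = 2 b\<close>
  (\<open>arm_diff_odd\<close>, \<open>arm_diff_even\<close>). Pairing consecutive values \<open>k = 2 i + 1\<close> and \<open>k = 2 i + 2\<close> and
  using \<open>(r - 1)\<^sub>2\<^sub>i\<^sub>+\<^sub>2 = (r - 1)\<^sub>2\<^sub>i\<^sub>+\<^sub>1 (r - 2 - 2 i)\<close> gives closed forms.

  For odd \<open>t\<close> both terms of a pair share the factor \<open>(r - 1)\<^sub>2\<^sub>i\<^sub>+\<^sub>1\<close>; apart from it, the first is positive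
  and of higher degree than the second, so the small part wins for large \<open>s\<close> (\<open>cross_diff_odd_pos\<close>). For \<open>t = 2 q\<close> both terms of a pair are multiples of the same
  \<open>g (q - 2 - i)\<close>, and the difference is the sum of \<open>(r - 1)\<^sub>2\<^sub>i\<^sub>+\<^sub>1 g (q - 2 - i) (r - q - 1 - i)\<close> over
  \<open>i < q - 1\<close> (\<open>cross_diff_even\<close>). If \<open>r \<ge> q + 2\<close>, the term \<open>i = 0\<close> is positive and of the highest degree.
  If \<open>r \<le> q + 1\<close>, no term is positive, and for large \<open>s\<close> some term is negative unless \<open>r = q + 1\<close> (which kills
  the term \<open>i = 0\<close>) and \<open>q = 2\<close> (which leaves no other term); that is the tie \<open>(t, r) = (4, 3)\<close>.\<close>

section \<open>Paths as vertex lists\<close>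

fun path_edges :: "'a list \<Rightarrow> 'a set set" where
  "path_edges (u # v # vs) = insert {u, v} (path_edges (v # vs))"
| "path_edges _ = {}"

text \<open>Copies of a path are counted through vertex lists, because lists can be cut at a vertex and
  extended one vertex at a time.\<close>

definition paths :: "'a ugraph \<Rightarrow> nat \<Rightarrow> 'a list set" where
  "paths G t = {xs. length xs = t \<and> distinct xs \<and> set xs \<subseteq> verts G \<and> path_edges xs \<subseteq> edges G}"

lemma path_edges_append:
  "path_edges (us @ x # vs) = path_edges (us @ [x]) \<union> path_edges (x # vs)"
  by (induction us rule: path_edges.induct) auto

lemma path_edges_rev: "path_edges (rev xs) = path_edges xs"
proof (induction xs rule: path_edges.induct)
  case (1 u v vs)
  have "path_edges (rev (u # v # vs)) = path_edges (rev vs @ [v]) \<union> path_edges [v, u]"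
    using path_edges_append[of "rev vs" v "[u]"] by simp
  with 1 show ?case by (auto simp: insert_commute)
qed auto

lemma path_edges_map: "path_edges (map h xs) = (`) h ` path_edges xs"
  by (induction xs rule: path_edges.induct) auto

lemma path_edges_nth: "path_edges xs = {{xs ! i, xs ! Suc i} |i. Suc i < length xs}"
proof (induction xs rule: path_edges.induct)
  case (1 u v vs)
  have "{{(u # v # vs) ! i, (u # v # vs) ! Suc i} |i. Suc i < length (u # v # vs)}
      = insert {u, v} {{(v # vs) ! i, (v # vs) ! Suc i} |i. Suc i < length (v # vs)}" (is "?L = ?R")
  proof
    show "?L \<subseteq> ?R"
    proof
      fix e assume "e \<in> ?L"
      then obtain i where i: "e = {(u # v # vs) ! i, (u # v # vs) ! Suc i}"
        "Suc i < length (u # v # vs)" by blast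
      show "e \<in> ?R"
        using i by (cases i) auto
    qed
    show "?R \<subseteq> ?L"
    proof
      fix e assume "e \<in> ?R"
      then consider "e = {u, v}" | i where "e = {(v # vs) ! i, (v # vs) ! Suc i}" "Suc i < length (v # vs)"
        by blast
      then show "e \<in> ?L"
      proof cases
        case 1 then show ?thesis by (intro CollectI exI[of _ 0]) auto
      next
        case (2 i) then show ?thesis by (intro CollectI exI[of _ "Suc i"]) auto
      qed
    qed
  qed
  with 1 show ?case by simp
qed auto

lemma path_edges_subset: "e \<in> path_edges xs \<Longrightarrow> e \<subseteq> set xs"
  by (induction xs rule: path_edges.induct) auto

lemma finite_paths: "finite (verts G) \<Longrightarrow> finite (paths G t)"
  by (rule finite_subset[OF _ finite_lists_length_eq[of "verts G" t]]) (auto simp: paths_def)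

lemma rev_paths: "rev xs \<in> paths G t \<longleftrightarrow> xs \<in> paths G t"
  by (simp add: paths_def path_edges_rev)

text \<open>A path is determined by its edges and one endpoint: the endpoint lies on a single edge, which
  identifies the next vertex, and the argument repeats after that edge is removed.\<close>

lemma path_edges_inj_hd:
  assumes "path_edges (a # xs) = path_edges (a # ys)" "distinct (a # xs)" "distinct (a # ys)"
    "length xs = length ys"
  shows "xs = ys"
  using assms
proof (induction xs arbitrary: a ys)
  case (Cons b xs)
  then obtain c zs where ys: "ys = c # zs" by (cases ys) auto
  have a: "a \<notin> e" if "e \<in> path_edges (b # xs) \<or> e \<in> path_edges (c # zs)" for e
    using that path_edges_subset[of e "b # xs"] path_edges_subset[of e "c # zs"] Cons.prems ys by auto
  have "{a, b} \<in> insert {a, c} (path_edges (c # zs))" using Cons.prems(1) ys by auto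
  then have bc: "b = c" using a[of "{a, b}"] by (auto simp: doubleton_eq_iff)
  have "path_edges (b # xs) = path_edges (a # b # xs) - {{a, b}}"
    using a[of "{a, b}"] by auto
  also have "\<dots> = path_edges (a # c # zs) - {{a, c}}" using Cons.prems(1) ys bc by simp
  also have "\<dots> = path_edges (c # zs)"
    using a[of "{a, c}"] by auto
  finally have "xs = zs" using Cons.IH[of b zs] Cons.prems ys bc by auto
  with bc ys show ?case by simp
qed simp

text \<open>An inner vertex of \<open>xs\<close> lies on two edges, while the first vertex of \<open>ys\<close> lies on one; so the
  first vertex of \<open>ys\<close> is an endpoint of \<open>xs\<close>.\<close>

lemma path_edges_inj:
  assumes eq: "path_edges xs = path_edges ys" "set xs = set ys"
    and d: "distinct xs" "distinct ys" and len: "length xs = length ys"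
  shows "ys = xs \<or> ys = rev xs"
proof (cases ys)
  case (Cons a zs)
  then have "a \<in> set xs" using eq(2) by simp
  then obtain us vs where xs: "xs = us @ a # vs" by (meson split_list)
  show ?thesis
  proof (cases "us = [] \<or> vs = []")
    case True
    then show ?thesis
    proof
      assume "us = []"
      then show ?thesis using path_edges_inj_hd[of a vs zs] eq d len Cons xs by auto
    next
      assume "vs = []"
      moreover have "path_edges (rev xs) = path_edges ys" using eq by (simp add: path_edges_rev)
      ultimately show ?thesis using path_edges_inj_hd[of a "rev us" zs] d len Cons xs by auto
    qed
  next
    case False
    then obtain u us' v vs' where uv: "us = us' @ [u]" "vs = v # vs'"
      by (metis neq_Nil_conv rev_exhaust)
    have "{u, a} \<in> path_edges xs" "{a, v} \<in> path_edges xs"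
      unfolding xs uv using path_edges_append[of us' u "a # v # vs'"] by simp_all
    then have "{u, a} \<in> path_edges (a # zs)" "{a, v} \<in> path_edges (a # zs)"
      using eq Cons by auto
    moreover have "{a, hd zs} = e" if "e \<in> path_edges (a # zs)" "a \<in> e" for e
      using that d Cons path_edges_subset[of e zs] by (cases zs) auto
    ultimately have "{a, hd zs} = {u, a}" "{a, hd zs} = {a, v}" by blast+
    moreover have "u \<noteq> v" "u \<noteq> a" "v \<noteq> a" using d xs uv by auto
    ultimately show ?thesis by (auto simp: doubleton_eq_iff)
  qed
qed (use len in auto)

definition list_graph :: "'a list \<Rightarrow> 'a ugraph" where
  "list_graph xs = \<lparr>verts = set xs, edges = path_edges xs\<rparr>"

lemma path_graph_isomorphic_list_graph:
  assumes "distinct xs" "length xs = t"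
  shows "isomorphic (list_graph xs) (path_graph t)"
proof -
  let ?f = "\<lambda>i. xs ! i" and ?g = "inv_into {..<t} ((!) xs)"
  have f: "bij_betw ?f {..<t} (set xs)" using assms by (simp add: bij_betw_nth)
  have "{u, v} \<in> path_edges xs \<longleftrightarrow> {?g u, ?g v} \<in> edges (path_graph t)"
    if uv: "u \<in> set xs" "v \<in> set xs" for u v
  proof -
    obtain i where i: "u = xs ! i" "i < t"
      using uv(1) assms by (auto simp: in_set_conv_nth)
    obtain j where j: "v = xs ! j" "j < t"
      using uv(2) assms by (auto simp: in_set_conv_nth)
    note ij = i j
    have g: "?g u = i" "?g v = j"
      using ij bij_betw_inv_into_left[OF f, of i] bij_betw_inv_into_left[OF f, of j] by auto
    have "{u, v} \<in> path_edges xs \<longleftrightarrow> (\<exists>k. Suc k < t \<and> {xs ! i, xs ! j} = {xs ! k, xs ! Suc k})"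
      unfolding path_edges_nth using assms ij by auto
    also have "\<dots> \<longleftrightarrow> (\<exists>k. Suc k < t \<and> {i, j} = {k, Suc k})"
      using assms ij by (auto simp: doubleton_eq_iff nth_eq_iff_index_eq)
    also have "\<dots> \<longleftrightarrow> {?g u, ?g v} \<in> edges (path_graph t)"
      unfolding g path_graph_def by auto
    finally show ?thesis .
  qed
  moreover have "bij_betw ?g (verts (list_graph xs)) (verts (path_graph t))"
    using bij_betw_inv_into[OF f] by (simp add: list_graph_def path_graph_def)
  ultimately show ?thesis
    unfolding isomorphic_def by (intro exI[of _ ?g]) (simp add: list_graph_def)
qed

lemma isomorphic_path_graph_imp_list_graph:
  assumes H: "simple_graph H" and iso: "isomorphic H (path_graph t)"
  obtains xs where "distinct xs" "length xs = t" "H = list_graph xs"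
proof -
  have "verts (path_graph t) = {..<t}" by (simp add: path_graph_def)
  then obtain f where f: "bij_betw f (verts H) {..<t}"
    and e: "\<And>u v. u \<in> verts H \<Longrightarrow> v \<in> verts H \<Longrightarrow> {u, v} \<in> edges H \<longleftrightarrow> {f u, f v} \<in> edges (path_graph t)"
    using iso unfolding isomorphic_def by metis
  let ?g = "inv_into (verts H) f"
  have g: "bij_betw ?g {..<t} (verts H)" by (rule bij_betw_inv_into[OF f])
  define xs where "xs = map ?g [0..<t]"
  have len: "length xs = t" by (simp add: xs_def)
  have nth: "xs ! i = ?g i" if "i < t" for i using that by (simp add: xs_def)
  have fg: "f (?g i) = i" if "i < t" for i using bij_betw_inv_into_right[OF f, of i] that by simp
  have gV: "?g i \<in> verts H" if "i < t" for i using bij_betwE[OF g] that by simp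
  have set: "set xs = verts H"
    using g by (simp add: xs_def bij_betw_def atLeast0LessThan)
  have dist: "distinct xs"
    using g by (simp add: xs_def distinct_map bij_betw_def atLeast0LessThan)
  have "edges H = path_edges xs"
  proof
    show "path_edges xs \<subseteq> edges H"
    proof
      fix x assume "x \<in> path_edges xs"
      then obtain i where i: "x = {?g i, ?g (Suc i)}" "Suc i < t"
        unfolding path_edges_nth len using nth by fastforce
      have "{f (?g i), f (?g (Suc i))} \<in> edges (path_graph t)"
        using i fg by (auto simp: path_graph_def)
      then show "x \<in> edges H" using e[of "?g i" "?g (Suc i)"] gV i by auto
    qed
    show "edges H \<subseteq> path_edges xs"
    proof
      fix x assume x: "x \<in> edges H"
      then obtain u v where uv: "x = {u, v}" "u \<in> verts H" "v \<in> verts H"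
        using H unfolding simple_graph_def by blast
      then have "{f u, f v} \<in> edges (path_graph t)" using e x by auto
      then obtain i where i: "{f u, f v} = {i, Suc i}" "Suc i < t"
        unfolding path_graph_def by auto
      have "{u, v} = ?g ` {f u, f v}"
        using uv f by (simp add: bij_betw_inv_into_left)
      also have "\<dots> = {xs ! i, xs ! Suc i}" unfolding i using i nth by simp
      finally show "x \<in> path_edges xs" unfolding path_edges_nth len uv using i by blast
    qed
  qed
  then have "H = list_graph xs" using set by (simp add: list_graph_def)
  with that dist len show ?thesis by blast
qed

lemma simple_list_graph:
  assumes "distinct xs"
  shows "simple_graph (list_graph xs)"
proof -
  have "e \<in> {{u, v} |u v. u \<in> set xs \<and> v \<in> set xs \<and> u \<noteq> v}" if "e \<in> path_edges xs" for e
    using that assms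
  proof (induction xs rule: path_edges.induct)
    case (1 u v vs)
    then show ?case by auto
  qed auto
  then show ?thesis by (auto simp: simple_graph_def list_graph_def)
qed

text \<open>Every copy of \<open>P\<^sub>t\<close> is the graph of exactly two lists, \<open>xs\<close> and \<open>rev xs\<close>, which differ as soon
  as there are two vertices.\<close>

lemma card_paths_eq_num_copies:
  assumes G: "finite (verts G)" and t: "t \<ge> 2"
  shows "card (paths G t) = 2 * num_copies (path_graph t) G"
proof -
  let ?C = "{H. subgraph_of H G \<and> isomorphic H (path_graph t)}"
  have C: "?C = list_graph ` paths G t"
  proof
    show "?C \<subseteq> list_graph ` paths G t"
    proof
      fix H assume H: "H \<in> ?C"
      then obtain xs where xs: "distinct xs" "length xs = t" "H = list_graph xs"
        using isomorphic_path_graph_imp_list_graph[of H t] unfolding subgraph_of_def by blast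
      then have "xs \<in> paths G t" using H by (simp add: paths_def subgraph_of_def list_graph_def)
      with xs show "H \<in> list_graph ` paths G t" by blast
    qed
    show "list_graph ` paths G t \<subseteq> ?C"
      using path_graph_isomorphic_list_graph simple_list_graph
      by (auto simp: paths_def subgraph_of_def) (auto simp: list_graph_def)
  qed
  have fin: "finite (paths G t)" using G by (rule finite_paths)
  have fiber: "card {xs \<in> paths G t. list_graph xs = H} = 2" if "H \<in> ?C" for H
  proof -
    from that obtain xs where xs: "xs \<in> paths G t" "H = list_graph xs" using C by blast
    have "{ys \<in> paths G t. list_graph ys = H} = {xs, rev xs}"
    proof
      show "{ys \<in> paths G t. list_graph ys = H} \<subseteq> {xs, rev xs}"
      proof
        fix ys assume "ys \<in> {ys \<in> paths G t. list_graph ys = H}"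
        then show "ys \<in> {xs, rev xs}"
          using xs path_edges_inj[of xs ys] by (simp add: list_graph_def paths_def)
      qed
      show "{xs, rev xs} \<subseteq> {ys \<in> paths G t. list_graph ys = H}"
        using xs by (auto simp: rev_paths) (simp add: list_graph_def path_edges_rev)
    qed
    moreover have "xs \<noteq> rev xs"
    proof
      assume eq: "xs = rev xs"
      have "distinct xs" "length xs \<ge> 2" using xs t by (auto simp: paths_def)
      moreover have "xs ! 0 = xs ! (length xs - 1)"
        using rev_nth[of 0 xs] eq \<open>length xs \<ge> 2\<close> by fastforce
      ultimately show False using nth_eq_iff_index_eq[of xs 0 "length xs - 1"] by force
    qed
    ultimately show ?thesis by simp
  qed
  have "card (paths G t) = (\<Sum>H\<in>?C. card {xs \<in> paths G t. list_graph xs = H})"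
    unfolding C card_eq_sum by (rule sum.image_gen[OF fin])
  also have "\<dots> = 2 * card ?C" using fiber by simp
  finally show ?thesis by (simp add: num_copies_def)
qed

section \<open>Paths through a cut vertex\<close>

definition map_graph :: "('a \<Rightarrow> 'b) \<Rightarrow> 'a ugraph \<Rightarrow> 'b ugraph" where
  "map_graph h G = \<lparr>verts = h ` verts G, edges = (`) h ` edges G\<rparr>"

definition graph_union :: "'a ugraph \<Rightarrow> 'a ugraph \<Rightarrow> 'a ugraph" where
  "graph_union G H = \<lparr>verts = verts G \<union> verts H, edges = edges G \<union> edges H\<rparr>"

text \<open>The start vertex \<open>x\<close> is left out of the list, so that the length is the number of edges and
  two arms at \<open>x\<close> can be glued around a single \<open>x\<close>.\<close>

definition arms :: "'a ugraph \<Rightarrow> 'a \<Rightarrow> nat \<Rightarrow> 'a list set" where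
  "arms G x k = {us. x # us \<in> paths G (Suc k)}"

lemma finite_arms: "finite (verts G) \<Longrightarrow> finite (arms G x k)"
  by (rule finite_subset[OF _ finite_lists_length_eq[of "verts G" k]]) (auto simp: arms_def paths_def)

lemma paths_map_graph:
  assumes "inj h"
  shows "paths (map_graph h G) t = map h ` paths G t"
proof -
  have *: "map h ys \<in> paths (map_graph h G) t \<longleftrightarrow> ys \<in> paths G t" for ys
    using assms unfolding paths_def map_graph_def mem_Collect_eq path_edges_map ugraph.simps
    by (simp add: distinct_map inj_image_subset_iff inj_on_image inj_on_subset[of _ UNIV]
        inj_image_subset_iff[of "(`) h", OF inj_on_image_Pow[OF assms, simplified]])
  have "\<exists>ys. xs = map h ys" if "xs \<in> paths (map_graph h G) t" for xs
  proof -
    have "set xs \<subseteq> range h" using that by (auto simp: paths_def map_graph_def)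
    then show ?thesis by (simp add: ex_map_conv) blast
  qed
  with * show ?thesis by blast
qed

lemma arms_map_graph:
  assumes "inj h"
  shows "arms (map_graph h G) (h x) k = map h ` arms G x k"
proof -
  have "us \<in> map h ` {us. x # us \<in> paths G (Suc k)}" if us: "h x # us \<in> map h ` paths G (Suc k)" for us
  proof -
    from us obtain zs where zs: "map h zs = h x # us" "zs \<in> paths G (Suc k)" by (metis imageE)
    then obtain z vs where "zs = z # vs" "h z = h x" "map h vs = us" by (auto simp: map_eq_Cons_conv)
    with zs injD[OF assms, of z x] show ?thesis by blast
  qed
  moreover have "h x # map h us \<in> map h ` paths G (Suc k)" if "x # us \<in> paths G (Suc k)" for us
    using imageI[OF that, of "map h"] by simp
  ultimately show ?thesis unfolding arms_def paths_map_graph[OF assms]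
    by (intro subset_antisym subsetI) auto
qed

lemma edges_map_graph_subset:
  "edges G \<subseteq> Pow (verts G) \<Longrightarrow> edges (map_graph h G) \<subseteq> Pow (verts (map_graph h G))"
  by (auto simp: map_graph_def)

text \<open>Neither graph has an edge between the two sides, so a path that starts off the cut vertex \<open>x\<close>
  can change sides only at \<open>x\<close>.\<close>

lemma path_stays_on_side:
  assumes "v \<in> V" "v \<noteq> x" "x \<notin> set vs" "path_edges (v # vs) \<subseteq> E \<union> F"
    and "E \<subseteq> Pow V" "F \<subseteq> Pow W" "V \<inter> W = {x}"
  shows "set (v # vs) \<subseteq> V \<and> path_edges (v # vs) \<subseteq> E"
  using assms(1-4)
proof (induction vs arbitrary: v)
  case (Cons w vs)
  have "{v, w} \<notin> F" using Cons.prems(1,2) assms(6,7) by blast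
  then have e: "{v, w} \<in> E" using Cons.prems(4) by simp
  then have "w \<in> V" using assms(5) by blast
  then have "set (w # vs) \<subseteq> V \<and> path_edges (w # vs) \<subseteq> E" using Cons by auto
  with e Cons.prems(1) show ?case by simp
qed simp

lemma arm_stays_on_side:
  assumes "v \<in> V" "v \<noteq> x" "x \<notin> set vs" "path_edges (x # v # vs) \<subseteq> E \<union> F"
    and "E \<subseteq> Pow V" "F \<subseteq> Pow W" "V \<inter> W = {x}"
  shows "set (x # v # vs) \<subseteq> V \<and> path_edges (x # v # vs) \<subseteq> E"
proof -
  have "{x, v} \<notin> F" using assms by blast
  then have "{x, v} \<in> E" using assms(4) by simp
  moreover have "set (v # vs) \<subseteq> V \<and> path_edges (v # vs) \<subseteq> E"
    using path_stays_on_side[of v V x vs E F W] assms by simp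
  ultimately show ?thesis using assms(7) by auto
qed

text \<open>The paths that come out of \<open>G\<close> and continue in \<open>H\<close>. The arm lengths \<open>k + 1\<close> and \<open>t - 2 - k\<close> add
  up to the \<open>t - 1\<close> edges of the path, and the bound on \<open>k\<close> keeps both of them positive.\<close>

definition crossing :: "'a ugraph \<Rightarrow> 'a ugraph \<Rightarrow> 'a \<Rightarrow> nat \<Rightarrow> 'a list set" where
  "crossing G H x t = {rev us @ x # vs | us vs. \<exists>k<t - 2. us \<in> arms G x (Suc k) \<and> vs \<in> arms H x (t - 2 - k)}"

lemma rev_crossing: "rev ` crossing G H x t = crossing H G x t"
proof -
  have *: "rev ` crossing G H x t \<subseteq> crossing H G x t" for G H :: "'a ugraph"
  proof
    fix xs assume "xs \<in> rev ` crossing G H x t"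
    then obtain us vs k where "xs = rev (rev us @ x # vs)" "k < t - 2"
      "us \<in> arms G x (Suc k)" "vs \<in> arms H x (t - 2 - k)" unfolding crossing_def by blast
    then have "xs = rev vs @ x # us" "t - 3 - k < t - 2"
      "vs \<in> arms H x (Suc (t - 3 - k))" "us \<in> arms G x (t - 2 - (t - 3 - k))"
      by (auto simp: Suc_diff_Suc numeral_3_eq_3 numeral_2_eq_2)
    then show "xs \<in> crossing H G x t" unfolding crossing_def by blast
  qed
  have "rev ` rev ` crossing H G x t \<subseteq> rev ` crossing G H x t" by (intro image_mono *)
  then show ?thesis using *[of G H] by (auto simp: image_image)
qed

text \<open>A crossing list contains \<open>x\<close> once, and its two arms are read off before and after \<open>x\<close>.\<close>

lemma card_crossing:
  assumes "finite (verts G)" "finite (verts H)"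
  shows "card (crossing G H x t) = (\<Sum>k<t - 2. card (arms G x (Suc k)) * card (arms H x (t - 2 - k)))"
proof -
  let ?join = "\<lambda>(us, vs). rev us @ x # vs"
  let ?A = "\<lambda>k. arms G x (Suc k) \<times> arms H x (t - 2 - k)"
  have "crossing G H x t = ?join ` (\<Union>k<t - 2. ?A k)"
    unfolding crossing_def by auto
  moreover have "inj_on ?join (\<Union>k<t - 2. ?A k)"
  proof (rule inj_onI)
    fix p q assume pq: "p \<in> (\<Union>k<t - 2. ?A k)" "q \<in> (\<Union>k<t - 2. ?A k)" "?join p = ?join q"
    obtain us vs us' vs' where [simp]: "p = (us, vs)" "q = (us', vs')" by fastforce
    have "x \<notin> set (rev us)" "x \<notin> set vs"
      using pq by (auto simp: arms_def paths_def)
    then show "p = q" using pq(3) append_Cons_eq_iff[of x "rev us" vs "rev us'" vs'] by simp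
  qed
  moreover have "card (\<Union>k<t - 2. ?A k) = (\<Sum>k<t - 2. card (?A k))"
    using assms by (intro card_UN_disjoint) (auto simp: finite_arms, auto simp: arms_def paths_def)
  ultimately show ?thesis by (simp add: card_image card_cartesian_product)
qed

text \<open>A path that avoids \<open>x\<close> stays on one side. A path that meets \<open>x\<close> splits there into two arms,
  each on one side; the path crosses iff both arms are nonempty and lie on different sides.\<close>

lemma paths_graph_union:
  assumes G: "edges G \<subseteq> Pow (verts G)" and H: "edges H \<subseteq> Pow (verts H)"
    and x: "verts G \<inter> verts H = {x}" and t: "t \<ge> 2"
  shows "paths (graph_union G H) t = (paths G t \<union> paths H t) \<union> (crossing G H x t \<union> crossing H G x t)"
proof
  show "paths (graph_union G H) t \<subseteq> (paths G t \<union> paths H t) \<union> (crossing G H x t \<union> crossing H G x t)"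
  proof
    fix xs assume xs: "xs \<in> paths (graph_union G H) t"
    then have xs': "distinct xs" "length xs = t" "set xs \<subseteq> verts G \<union> verts H"
      "path_edges xs \<subseteq> edges G \<union> edges H" "path_edges xs \<subseteq> edges H \<union> edges G"
      by (auto simp: paths_def graph_union_def)
    have x': "verts H \<inter> verts G = {x}" using x by blast
    show "xs \<in> (paths G t \<union> paths H t) \<union> (crossing G H x t \<union> crossing H G x t)"
    proof (cases "x \<in> set xs")
      case False
      obtain v vs where v: "xs = v # vs" using xs' t by (cases xs) auto
      then consider "v \<in> verts G" "v \<noteq> x" | "v \<in> verts H" "v \<noteq> x" using xs' False by auto
      then show ?thesis
      proof cases
        case 1
        have "xs \<in> paths G t"
          using path_stays_on_side[OF 1, of vs "edges G" "edges H" "verts H"] xs' v False G H x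
          by (simp add: paths_def)
        then show ?thesis by blast
      next
        case 2
        have "xs \<in> paths H t"
          using path_stays_on_side[OF 2, of vs "edges H" "edges G" "verts G"] xs' v False G H x'
          by (simp add: paths_def)
        then show ?thesis by blast
      qed
    next
      case True
      then obtain us vs where split: "xs = us @ x # vs" by (meson split_list)
      define ws where "ws = rev us"
      have us: "us = rev ws" by (simp add: ws_def)
      have arm: "x # zs \<in> paths G (Suc (length zs)) \<or> x # zs \<in> paths H (Suc (length zs))"
        if "zs \<in> {ws, vs}" for zs
      proof -
        have pe: "path_edges (x # zs) \<subseteq> edges G \<union> edges H" "path_edges (x # zs) \<subseteq> edges H \<union> edges G"
        proof -
          have "path_edges (x # ws) = path_edges (us @ [x])"
            using path_edges_rev[of "x # ws"] us by simp
          then show "path_edges (x # zs) \<subseteq> edges G \<union> edges H"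
            using that xs'(4) path_edges_append[of us x vs] split by auto
          then show "path_edges (x # zs) \<subseteq> edges H \<union> edges G" by blast
        qed
        have d: "distinct (x # zs)" "set zs \<subseteq> verts G \<union> verts H"
          using xs' split us that by auto
        show ?thesis
        proof (cases zs)
          case Nil
          then show ?thesis using x by (auto simp: paths_def)
        next
          case (Cons v zs')
          then consider "v \<in> verts G" "v \<noteq> x" | "v \<in> verts H" "v \<noteq> x" using d by auto
          then show ?thesis
          proof cases
            case 1
            show ?thesis
              using arm_stays_on_side[OF 1, of zs' "edges G" "edges H" "verts H"] pe d(1) Cons G H x
              by (simp add: paths_def)
          next
            case 2
            show ?thesis
              using arm_stays_on_side[OF 2, of zs' "edges H" "edges G" "verts G"] pe d(1) Cons G H x'
              by (simp add: paths_def)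
          qed
        qed
      qed
      have len: "length ws + length vs = t - 1" using xs' split us by auto
      have same: "xs \<in> paths K t" if "x # ws \<in> paths K (Suc (length ws))"
        "x # vs \<in> paths K (Suc (length vs))" for K
      proof -
        have "path_edges xs = path_edges (x # ws) \<union> path_edges (x # vs)"
          using path_edges_rev[of "x # ws"] split us path_edges_append[of us x vs] by simp
        with that show ?thesis using xs' split us by (auto simp: paths_def)
      qed
      have cross: "xs \<in> crossing K L x t" if "x # ws \<in> paths K (Suc (length ws))"
        "x # vs \<in> paths L (Suc (length vs))" "ws \<noteq> []" "vs \<noteq> []" for K L
      proof -
        obtain k where k: "length ws = Suc k" using \<open>ws \<noteq> []\<close> by (cases ws) auto
        moreover have "length vs \<noteq> 0" using \<open>vs \<noteq> []\<close> by simp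
        ultimately have "length vs = t - 2 - k" "k < t - 2" using len by linarith+
        with k that show ?thesis unfolding crossing_def arms_def split us by auto
      qed
      have nil: "[x] \<in> paths K (Suc 0)" if "K \<in> {G, H}" for K
        using that x by (auto simp: paths_def)
      consider "ws = []" | "vs = []" | "ws \<noteq> []" "vs \<noteq> []" by blast
      then show ?thesis
      proof cases
        case 1
        then show ?thesis using arm[of vs] same[of G] same[of H] nil[of G] nil[of H] by auto
      next
        case 2
        then show ?thesis using arm[of ws] same[of G] same[of H] nil[of G] nil[of H] by auto
      next
        case 3
        then show ?thesis
          using arm[of ws] arm[of vs] same[of G] same[of H] cross[of G H] cross[of H G] by blast
      qed
    qed
  qed
  have cr: "crossing K L x t \<subseteq> paths (graph_union G H) t" if KL: "{K, L} = {G, H}" for K L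
  proof
    fix xs assume "xs \<in> crossing K L x t"
    then obtain us vs k where xs: "xs = rev us @ x # vs" "k < t - 2"
      and u: "us \<in> arms K x (Suc k)" and v: "vs \<in> arms L x (t - 2 - k)" unfolding crossing_def by blast
    have KL': "verts K \<inter> verts L = {x}" "verts K \<union> verts L = verts G \<union> verts H"
      "edges K \<union> edges L = edges G \<union> edges H"
      using KL x by (auto simp: doubleton_eq_iff)
    have "path_edges xs = path_edges (x # us) \<union> path_edges (x # vs)"
      using path_edges_rev[of "x # us"] path_edges_append[of "rev us" x vs] xs(1) by simp
    then have "path_edges xs \<subseteq> edges G \<union> edges H"
      using u v KL' by (auto simp: arms_def paths_def)
    moreover have "set xs \<subseteq> verts G \<union> verts H" using u v KL' xs(1) by (auto simp: arms_def paths_def)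
    moreover have "distinct xs" using u v KL'(1) xs(1) by (fastforce simp: arms_def paths_def)
    moreover have "length xs = t" using u v xs by (auto simp: arms_def paths_def)
    ultimately show "xs \<in> paths (graph_union G H) t" by (simp add: paths_def graph_union_def)
  qed
  have "paths G t \<union> paths H t \<subseteq> paths (graph_union G H) t"
    by (auto simp: paths_def graph_union_def)
  then show "(paths G t \<union> paths H t) \<union> (crossing G H x t \<union> crossing H G x t) \<subseteq> paths (graph_union G H) t"
    using cr[of G H] cr[of H G] by (simp add: insert_commute)
qed

text \<open>The four sets of \<open>paths_graph_union\<close> are disjoint: two vertices do not fit into the
  intersection \<open>{x}\<close>, and a crossing path leaves \<open>x\<close> in both graphs, starting in the one that names its kind. Reversal exchanges the two
  kinds of crossing paths, hence the factor 2.\<close>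

lemma card_paths_graph_union:
  assumes fin: "finite (verts G)" "finite (verts H)"
    and G: "edges G \<subseteq> Pow (verts G)" and H: "edges H \<subseteq> Pow (verts H)"
    and x: "verts G \<inter> verts H = {x}" and t: "t \<ge> 2"
  shows "card (paths (graph_union G H) t) = card (paths G t) + card (paths H t)
    + 2 * (\<Sum>k<t - 2. card (arms G x (Suc k)) * card (arms H x (t - 2 - k)))"
proof -
  have leaves: "\<exists>v\<in>set xs. v \<in> verts K \<and> v \<notin> verts L"
    if "xs \<in> crossing K L x t \<or> xs \<in> crossing L K x t" "verts K \<inter> verts L = {x}" for K L xs
  proof -
    from that(1) have "xs \<in> crossing K L x t \<or> rev xs \<in> crossing K L x t"
      unfolding rev_crossing[of L K x t, symmetric] by auto
    then obtain us vs k where us: "us \<in> arms K x (Suc k)"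
      and "xs = rev us @ x # vs \<or> rev xs = rev us @ x # vs" unfolding crossing_def by blast
    then have sub: "set us \<subseteq> set xs" by (metis Un_upper1 set_append set_rev)
    from us obtain v where v: "v \<in> set us" by (cases us) (auto simp: arms_def paths_def)
    moreover have "v \<in> verts K" "v \<noteq> x" using us v by (auto simp: arms_def paths_def)
    ultimately show ?thesis using that(2) us sub by auto
  qed
  have x': "verts H \<inter> verts G = {x}" using x by blast
  have d1: "paths G t \<inter> paths H t = {}"
  proof (rule ccontr)
    assume "paths G t \<inter> paths H t \<noteq> {}"
    then obtain xs where xs: "distinct xs" "length xs = t" "set xs \<subseteq> {x}"
      using x unfolding paths_def by blast
    then have "card (set xs) \<le> card {x}" by (intro card_mono) auto
    then show False using xs t by (simp add: distinct_card)
  qed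
  have d2: "(paths G t \<union> paths H t) \<inter> (crossing G H x t \<union> crossing H G x t) = {}"
    using leaves[OF _ x] leaves[OF _ x'] unfolding paths_def by blast
  have d3: "crossing G H x t \<inter> crossing H G x t = {}"
  proof (rule ccontr)
    assume "crossing G H x t \<inter> crossing H G x t \<noteq> {}"
    then obtain us vs us' vs' k k' where eq: "rev us @ x # vs = rev us' @ x # vs'"
      and u: "us \<in> arms G x (Suc k)" "us' \<in> arms H x (Suc k')"
      and v: "vs \<in> arms H x (t - 2 - k)"
      unfolding crossing_def by blast
    have "x \<notin> set (rev us)" "x \<notin> set vs" using u v by (auto simp: arms_def paths_def)
    then have "us = us'" using eq append_Cons_eq_iff[of x "rev us" vs "rev us'" vs'] by simp
    then have "set us \<subseteq> {x}" "x \<notin> set us" "us \<noteq> []" using u x by (auto simp: arms_def paths_def)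
    then show False by (cases us) auto
  qed
  have "finite (crossing G H x t)" "finite (crossing H G x t)" "finite (paths G t)" "finite (paths H t)"
    using finite_paths[of "graph_union G H" t] paths_graph_union[OF G H x t] fin
    by (auto simp: graph_union_def)
  then have "card (paths (graph_union G H) t) = card (paths G t) + card (paths H t)
      + (card (crossing G H x t) + card (crossing H G x t))"
    unfolding paths_graph_union[OF G H x t] using d1 d2 d3 by (simp add: card_Un_disjoint)
  also have "card (crossing H G x t) = card (crossing G H x t)"
    unfolding rev_crossing[of G H x t, symmetric] by (rule card_image) simp
  finally show ?thesis using card_crossing[OF fin] by simp
qed

lemma suspend_eq_graph_union:
  "suspend B x H y = graph_union (map_graph (\<lambda>v. if v = y then Inl x else Inr v) H) (map_graph Inl B)"
  by (simp add: suspend_def graph_union_def map_graph_def Let_def Un_commute)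

lemma card_paths_suspend:
  fixes B :: "'a ugraph" and H :: "'b ugraph"
  assumes fin: "finite (verts B)" "finite (verts H)"
    and B: "edges B \<subseteq> Pow (verts B)" and H: "edges H \<subseteq> Pow (verts H)"
    and xy: "x \<in> verts B" "y \<in> verts H" and t: "t \<ge> 2"
  shows "card (paths (suspend B x H y) t) = card (paths B t) + card (paths H t)
    + 2 * (\<Sum>k<t - 2. card (arms H y (Suc k)) * card (arms B x (t - 2 - k)))"
proof -
  let ?i = "Inl :: 'a \<Rightarrow> 'a + 'b" and ?g = "\<lambda>v. if v = y then Inl x else Inr v"
  have inj: "inj ?i" "inj ?g" by (auto simp: inj_def)
  have "verts (map_graph ?g H) \<inter> verts (map_graph ?i B) = {Inl x}"
    using xy by (auto simp: map_graph_def split: if_splits)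
  then have "card (paths (suspend B x H y) t)
    = card (paths (map_graph ?g H) t) + card (paths (map_graph ?i B) t)
    + 2 * (\<Sum>k<t - 2. card (arms (map_graph ?g H) (Inl x) (Suc k)) * card (arms (map_graph ?i B) (Inl x) (t - 2 - k)))"
    unfolding suspend_eq_graph_union
  proof (intro card_paths_graph_union edges_map_graph_subset B H t)
    show "finite (verts (map_graph ?g H))" "finite (verts (map_graph ?i B))"
      using fin by (simp_all add: map_graph_def)
  qed
  moreover have "arms (map_graph ?g H) (Inl x) k = map ?g ` arms H y k" for k
    using arms_map_graph[OF inj(2), of H y k] by simp
  ultimately show ?thesis
    by (simp add: paths_map_graph[OF inj(1)] paths_map_graph[OF inj(2)] arms_map_graph[OF inj(1)]
        card_image inj_on_subset[OF inj_mapI[OF inj(1)] subset_UNIV]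
        inj_on_subset[OF inj_mapI[OF inj(2)] subset_UNIV])
qed

section \<open>Arms in cliques and in complete bipartite graphs\<close>

fun falling :: "nat \<Rightarrow> nat \<Rightarrow> nat" where
  "falling n 0 = 1"
| "falling n (Suc k) = n * falling (n - 1) k"

text \<open>Stated over the integers: there it holds for \<open>k > n\<close> as well, where both sides vanish, so no
  bound relating \<open>r\<close> to \<open>t\<close> has to be carried along below.\<close>

lemma falling_Suc_right: "int (falling n (Suc k)) = int (falling n k) * (int n - int k)"
proof (induction k arbitrary: n)
  case (Suc k)
  show ?case
  proof (cases n)
    case (Suc m)
    have "int (falling n (Suc (Suc k))) = int n * int (falling m (Suc k))"
      unfolding falling.simps(2)[of n "Suc k"] unfolding Suc by (simp del: falling.simps add: algebra_simps)
    also have "\<dots> = int n * int (falling m k) * (int m - int k)" by (simp only: Suc.IH mult.assoc)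
    finally show ?thesis
      unfolding falling.simps(2)[of n k] unfolding Suc by (simp del: falling.simps add: algebra_simps)
  qed simp
qed simp

lemma falling_pos: "k \<le> n \<Longrightarrow> falling n k > 0"
  by (induction k arbitrary: n) auto

lemma card_Cons_lists:
  assumes "finite B" "\<And>v. v \<in> B \<Longrightarrow> finite (P v)" "\<And>v. v \<in> B \<Longrightarrow> card (P v) = c"
  shows "card {v # vs | v vs. v \<in> B \<and> vs \<in> P v} = card B * c"
proof -
  have "{v # vs | v vs. v \<in> B \<and> vs \<in> P v} = (\<lambda>(v, vs). v # vs) ` Sigma B P" by auto
  moreover have "inj_on (\<lambda>(v, vs). v # vs) (Sigma B P)" by (auto simp: inj_on_def)
  ultimately show ?thesis using assms by (simp add: card_image)
qed

lemma card_distinct_lists: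
  assumes "finite A"
  shows "card {vs. length vs = k \<and> distinct vs \<and> set vs \<subseteq> A} = falling (card A) k"
  using assms
proof (induction k arbitrary: A)
  case 0
  have "{vs. length vs = 0 \<and> distinct vs \<and> set vs \<subseteq> A} = {[]}" by auto
  then show ?case by simp
next
  case (Suc k)
  let ?P = "\<lambda>v. {vs. length vs = k \<and> distinct vs \<and> set vs \<subseteq> A - {v}}"
  have "{vs. length vs = Suc k \<and> distinct vs \<and> set vs \<subseteq> A} = {v # vs | v vs. v \<in> A \<and> vs \<in> ?P v}"
    by (auto simp: length_Suc_conv)
  also have "card \<dots> = card A * falling (card A - 1) k"
  proof (rule card_Cons_lists[OF Suc.prems])
    fix v assume v: "v \<in> A"
    show "finite (?P v)"
      using Suc.prems by (auto intro: finite_subset[OF _ finite_lists_length_eq[of A k]])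
    show "card (?P v) = falling (card A - 1) k" using Suc.IH[of "A - {v}"] Suc.prems v by simp
  qed
  finally show ?case by simp
qed

text \<open>A walk in a bipartite graph that has just left a vertex of \<open>A\<close>: its next vertex is in \<open>B\<close>, and
  then the roles are exchanged.\<close>

fun alternating :: "'a set \<Rightarrow> 'a set \<Rightarrow> 'a list \<Rightarrow> bool" where
  "alternating A B [] \<longleftrightarrow> True"
| "alternating A B (v # vs) \<longleftrightarrow> v \<in> B \<and> alternating B A vs"

lemma alternating_remove:
  assumes "v \<notin> A"
  shows "alternating A (B - {v}) vs \<longleftrightarrow> alternating A B vs \<and> v \<notin> set vs"
    and "alternating (B - {v}) A vs \<longleftrightarrow> alternating B A vs \<and> v \<notin> set vs"
  using assms by (induction vs) auto

lemma alternating_subset: "alternating A B vs \<Longrightarrow> set vs \<subseteq> A \<union> B"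
  by (induction vs arbitrary: A B) fastforce+

text \<open>Choosing the first vertex in \<open>B\<close> leaves \<open>B\<close> one vertex smaller and exchanges the roles of \<open>A\<close>
  and \<open>B\<close>; this is how the two falling factorials grow in turn.\<close>

lemma card_alternating_lists:
  assumes "finite A" "finite B" "A \<inter> B = {}"
  shows "card {vs. length vs = k \<and> distinct vs \<and> alternating A B vs}
    = falling (card A) (k div 2) * falling (card B) (Suc k div 2)"
  using assms
proof (induction k arbitrary: A B)
  case 0
  have "{vs. length vs = 0 \<and> distinct vs \<and> alternating A B vs} = {[]}" by auto
  then show ?case by simp
next
  case (Suc k)
  let ?P = "\<lambda>v. {vs. length vs = k \<and> distinct vs \<and> alternating (B - {v}) A vs}"
  have "alternating (B - {v}) A vs \<longleftrightarrow> alternating B A vs \<and> v \<notin> set vs" if "v \<in> B" for v vs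
    using alternating_remove(2)[of v A B] that Suc.prems by blast
  then have "{vs. length vs = Suc k \<and> distinct vs \<and> alternating A B vs} = {v # vs | v vs. v \<in> B \<and> vs \<in> ?P v}"
    by (auto simp: length_Suc_conv)
  also have "card \<dots> = card B * (falling (card B - 1) (k div 2) * falling (card A) (Suc k div 2))"
  proof (rule card_Cons_lists[OF Suc.prems(2)])
    fix v assume v: "v \<in> B"
    show "finite (?P v)"
      using Suc.prems alternating_subset[of "B - {v}" A]
      by (intro finite_subset[OF _ finite_lists_length_eq[of "A \<union> B" k]]) auto
    show "card (?P v) = falling (card B - 1) (k div 2) * falling (card A) (Suc k div 2)"
      using Suc.IH[of "B - {v}" A] Suc.prems v by auto
  qed
  finally show ?case by simp
qed

lemma arms_complete_graph:
  assumes "y < r"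
  shows "card (arms (complete_graph r) y k) = falling (r - 1) k"
proof -
  have V: "verts (complete_graph r) = {..<r}" by (simp add: complete_graph_def)
  have *: "path_edges vs \<subseteq> edges (complete_graph r)" if "distinct vs" "set vs \<subseteq> {..<r}" for vs
    using that by (induction vs rule: path_edges.induct) (auto simp: complete_graph_def)
  have "us \<in> arms (complete_graph r) y k \<longleftrightarrow> length us = k \<and> distinct us \<and> set us \<subseteq> {..<r} - {y}" for us
    using assms *[of "y # us"] by (auto simp: arms_def paths_def V)
  then have "arms (complete_graph r) y k = {vs. length vs = k \<and> distinct vs \<and> set vs \<subseteq> {..<r} - {y}}"
    by blast
  then show ?thesis using assms by (simp add: card_distinct_lists)
qed

lemma path_edges_bipartite:
  assumes "X \<inter> Y = {}" "x \<in> X"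
  shows "path_edges (x # vs) \<subseteq> {{u, v} | u v. u \<in> X \<and> v \<in> Y} \<longleftrightarrow> alternating X Y vs"
  using assms
proof (induction vs arbitrary: x X Y)
  case (Cons v vs)
  have "{x, v} \<in> {{u, v} | u v. u \<in> X \<and> v \<in> Y} \<longleftrightarrow> v \<in> Y"
    using Cons.prems by (auto simp: doubleton_eq_iff)
  moreover have "{{u, v} | u v. u \<in> X \<and> v \<in> Y} = {{u, v} | u v. u \<in> Y \<and> v \<in> X}"
    by (auto simp: insert_commute)
  moreover have "Y \<inter> X = {}" using Cons.prems by blast
  ultimately show ?case using Cons.IH[of Y X v] by auto
qed simp

text \<open>The start vertex is used up, which reduces its own part \<open>X\<close> by one.\<close>

lemma card_arms_bipartite:
  assumes "finite X" "finite Y" "X \<inter> Y = {}" "x \<in> X"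
    and "verts G = X \<union> Y" "edges G = {{u, v} | u v. u \<in> X \<and> v \<in> Y}"
  shows "card (arms G x k) = falling (card X - 1) (k div 2) * falling (card Y) (Suc k div 2)"
proof -
  have "x \<notin> Y" using assms by blast
  then have "arms G x k = {vs. length vs = k \<and> distinct vs \<and> alternating (X - {x}) Y vs}"
    unfolding arms_def paths_def assms(5,6) mem_Collect_eq path_edges_bipartite[OF assms(3,4)]
    using alternating_remove(2)[OF \<open>x \<notin> Y\<close>, of X] alternating_subset[of X Y] assms(4) by auto
  also have "card \<dots> = falling (card (X - {x})) (k div 2) * falling (card Y) (Suc k div 2)"
    using assms by (intro card_alternating_lists) auto
  finally show ?thesis using assms by simp
qed

text \<open>Meaningful for \<open>x < m\<close>, where a vertex outside the small part is in the large one.\<close>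

definition part_of :: "nat \<Rightarrow> nat \<Rightarrow> nat set" where
  "part_of m x = (if x \<in> small_part m then small_part m else large_part m)"

lemma card_arms_turan2:
  assumes "x < m"
  defines "a \<equiv> card (part_of m x)"
  shows "card (arms (turan2 m) x k) = falling (a - 1) (k div 2) * falling (m - a) (Suc k div 2)"
proof -
  have fin: "finite (small_part m)" "finite (large_part m)" "small_part m \<inter> large_part m = {}"
    "large_part m \<inter> small_part m = {}"
    by (auto simp: small_part_def large_part_def)
  have e: "edges (turan2 m) = {{u, v} | u v. u \<in> large_part m \<and> v \<in> small_part m}"
    unfolding turan2_def by (auto simp: insert_commute)
  show ?thesis
  proof (cases "x \<in> small_part m")
    case True
    moreover have "card (large_part m) = m - card (small_part m)"
      by (simp add: small_part_def large_part_def)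
    ultimately show ?thesis
      using card_arms_bipartite[of "small_part m" "large_part m" x "turan2 m" k] fin
      by (simp add: a_def part_of_def turan2_def)
  next
    case False
    then have "x \<in> large_part m" using assms by (auto simp: small_part_def large_part_def)
    moreover have "card (small_part m) = m - card (large_part m)"
      by (simp add: small_part_def large_part_def)
    ultimately show ?thesis
      using card_arms_bipartite[of "large_part m" "small_part m" x "turan2 m" k] fin e False
      by (simp add: a_def part_of_def turan2_def Un_commute)
  qed
qed

text \<open>The number of copies of \<open>P\<^sub>t\<close> that cross from the clique \<open>K\<^sub>r\<close> into a complete bipartite graph
  when the cut vertex lies in the part of size \<open>a\<close> and the other part has size \<open>b\<close>.\<close>

definition cross_count :: "nat \<Rightarrow> nat \<Rightarrow> nat \<Rightarrow> nat \<Rightarrow> nat" where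
  "cross_count t r a b = (\<Sum>k<t - 2. falling (r - 1) (Suc k) *
     (falling (a - 1) ((t - 2 - k) div 2) * falling b (Suc (t - 2 - k) div 2)))"

text \<open>Only the last summand depends on \<open>x\<close>, and only through the part that contains \<open>x\<close>. Lists are
  counted, so everything appears twice.\<close>

lemma num_copies_suspend_turan2:
  assumes "x < m" "y < r" "t \<ge> 2"
  shows "2 * num_copies (path_graph t) (suspend (turan2 m) x (complete_graph r) y)
    = card (paths (turan2 m) t) + card (paths (complete_graph r) t)
      + 2 * cross_count t r (card (part_of m x)) (m - card (part_of m x))"
proof -
  let ?B = "turan2 m" and ?H = "complete_graph r"
  have V: "verts ?B = {..<m}" "verts ?H = {..<r}"
    by (auto simp: turan2_def small_part_def large_part_def complete_graph_def)
  have E: "edges ?B \<subseteq> Pow (verts ?B)" "edges ?H \<subseteq> Pow (verts ?H)"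
    by (auto simp: turan2_def complete_graph_def)
  have "finite (verts (suspend ?B x ?H y))"
    by (simp add: suspend_def V)
  then have "2 * num_copies (path_graph t) (suspend ?B x ?H y) = card (paths (suspend ?B x ?H y) t)"
    using assms by (simp add: card_paths_eq_num_copies)
  also have "\<dots> = card (paths ?B t) + card (paths ?H t)
    + 2 * (\<Sum>k<t - 2. card (arms ?H y (Suc k)) * card (arms ?B x (t - 2 - k)))"
    using assms E by (intro card_paths_suspend) (simp_all add: V)
  finally show ?thesis
    unfolding cross_count_def arms_complete_graph[OF assms(2)] card_arms_turan2[OF assms(1)] .
qed

section \<open>Small part against large part\<close>

text \<open>As a polynomial in \<open>s\<close> it has degree \<open>2 b\<close>, so \<open>b\<close> measures the order of growth; the whole
  comparison is expressed in these functions.\<close>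

definition falling_prod :: "nat \<Rightarrow> nat \<Rightarrow> int" where
  "falling_prod s b = int (falling s b) * int (falling (s - 1) b)"

text \<open>The advantage, in arms with \<open>j\<close> edges, of a start vertex in the part of size \<open>s\<close> over one in
  the part of size \<open>s + 1\<close>.\<close>

definition arm_diff :: "nat \<Rightarrow> nat \<Rightarrow> int" where
  "arm_diff s j = int (falling (s - 1) (j div 2) * falling (s + 1) (Suc j div 2))
     - int (falling s (j div 2) * falling s (Suc j div 2))"

lemma falling_prod_Suc: "s \<ge> 1 \<Longrightarrow> falling_prod s (Suc b) = falling_prod s b * ((int s - int b) * (int s - 1 - int b))"
  by (simp add: falling_prod_def falling_Suc_right of_nat_diff del: falling.simps)

text \<open>Both products have degree \<open>2 b\<close>, and their two leading coefficients agree: after the common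
  factor \<open>falling_prod s (b - 1)\<close> is taken out, the rest is
  \<open>(s + 1) (s - b) - s (s - b + 1) = - b\<close>. For \<open>b = 0\<close> the truncated index is harmless because of the
  factor \<open>b\<close>.\<close>

lemma arm_diff_even:
  assumes "s \<ge> 1"
  shows "arm_diff s (2 * b) = - int b * falling_prod s (b - 1)"
proof (cases b)
  case 0
  then show ?thesis by (simp add: arm_diff_def)
next
  case (Suc c)
  let ?f = "int (falling s c)" and ?f' = "int (falling (s - 1) c)"
  have 1: "int (falling (s - 1) b) = ?f' * (int s - 1 - int c)"
    unfolding Suc falling_Suc_right using assms by (simp add: of_nat_diff)
  have 2: "int (falling (s + 1) b) = (int s + 1) * ?f"
    unfolding Suc by (simp add: algebra_simps)
  have 3: "int (falling s b) = ?f * (int s - int c)"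
    unfolding Suc falling_Suc_right by simp
  have 4: "int (falling s b) = int s * ?f'" unfolding Suc by simp
  have "arm_diff s (2 * b) = int (falling (s - 1) b) * int (falling (s + 1) b) - int (falling s b) * int (falling s b)"
    by (simp add: arm_diff_def)
  also have "\<dots> = ?f' * (int s - 1 - int c) * ((int s + 1) * ?f) - ?f * (int s - int c) * (int s * ?f')"
    using 1 2 3 4 by metis
  also have "\<dots> = - (int c + 1) * (?f * ?f')" by (simp add: algebra_simps)
  finally show ?thesis using Suc by (simp add: falling_prod_def)
qed

text \<open>With an odd number of edges, the arm visits the opposite part once more than its own, and a
  start vertex in the small part has the larger opposite part.\<close>

lemma arm_diff_odd: "arm_diff s (2 * b + 1) = falling_prod s b"
proof -
  have "arm_diff s (2 * b + 1) = int (falling (s - 1) b) * int (falling (s + 1) (Suc b)) - int (falling s b) * int (falling s (Suc b))"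
    by (simp add: arm_diff_def)
  also have "\<dots> = falling_prod s b" by (simp add: falling_prod_def algebra_simps)
  finally show ?thesis .
qed

lemma falling_prod_pos: "b < s \<Longrightarrow> falling_prod s b > 0"
  by (simp add: falling_prod_def falling_pos)

text \<open>The difference in degree, in quantitative form: from index \<open>b\<close> to \<open>b + 1\<close> the value is
  multiplied by \<open>(s - b) (s - 1 - b)\<close>.\<close>

lemma falling_prod_dominates:
  assumes "c < b" "s \<ge> b + M" "M \<ge> 1"
  shows "int M * falling_prod s c \<le> falling_prod s b"
  using assms(1,2)
proof (induction b)
  case (Suc b)
  have pos: "falling_prod s b > 0" using Suc.prems assms(3) by (intro falling_prod_pos) simp
  have "int M * 1 \<le> (int s - int b) * (int s - 1 - int b)"
    using Suc.prems assms(3) by (intro mult_mono) auto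
  then have step: "int M * falling_prod s b \<le> falling_prod s (Suc b)"
    using pos Suc.prems assms(3) by (simp add: falling_prod_Suc mult.commute)
  show ?case
  proof (cases "c = b")
    case False
    then have "int M * falling_prod s c \<le> falling_prod s b" using Suc by simp
    also have "\<dots> \<le> int M * falling_prod s b" using pos assms(3) by simp
    finally show ?thesis using step by simp
  qed (use step in simp)
qed simp

definition cross_diff :: "nat \<Rightarrow> nat \<Rightarrow> nat \<Rightarrow> int" where
  "cross_diff t r s = int (cross_count t r s (s + 1)) - int (cross_count t r (s + 1) s)"

lemma cross_diff_eq_sum:
  "cross_diff t r s = (\<Sum>k<t - 2. int (falling (r - 1) (Suc k)) * arm_diff s (t - 2 - k))"
  by (simp add: cross_diff_def cross_count_def arm_diff_def sum_subtractf[symmetric] right_diff_distrib)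

lemma sum_pairs: "(\<Sum>k<2 * h. c k) = (\<Sum>i<h. c (2 * i) + c (2 * i + 1))"
  for c :: "nat \<Rightarrow> 'a::comm_monoid_add"
  by (induction h) (simp_all add: ac_simps)

lemma falling_next: "r \<ge> 1 \<Longrightarrow> int (falling (r - 1) (2 * i + 2)) = int (falling (r - 1) (2 * i + 1)) * (int r - 2 - 2 * int i)"
  using falling_Suc_right[of "r - 1" "2 * i + 1"] by (simp add: of_nat_diff algebra_simps)

text \<open>In the pair \<open>k = 2 i + 1\<close>, \<open>2 i + 2\<close> the remaining arms have \<open>2 (q - 1 - i)\<close> and
  \<open>2 (q - 2 - i) + 1\<close> edges. Both differences are multiples of \<open>falling_prod s (q - 2 - i)\<close>, with
  coefficients \<open>- (q - 1 - i)\<close> and \<open>r - 2 - 2 i\<close>.\<close>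

lemma cross_diff_even:
  assumes "q \<ge> 2" "r \<ge> 1" "s \<ge> 1"
  shows "cross_diff (2 * q) r s
    = (\<Sum>i<q - 1. int (falling (r - 1) (2 * i + 1)) * falling_prod s (q - 2 - i) * (int r - int q - 1 - int i))"
proof -
  let ?c = "\<lambda>k. int (falling (r - 1) (Suc k)) * arm_diff s (2 * q - 2 - k)"
  have "cross_diff (2 * q) r s = (\<Sum>k<2 * (q - 1). ?c k)"
    by (simp add: cross_diff_eq_sum diff_mult_distrib2)
  also have "\<dots> = (\<Sum>i<q - 1. ?c (2 * i) + ?c (2 * i + 1))" by (rule sum_pairs)
  also have "\<dots> = (\<Sum>i<q - 1. int (falling (r - 1) (2 * i + 1)) * falling_prod s (q - 2 - i) * (int r - int q - 1 - int i))"
  proof (rule sum.cong[OF refl])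
    fix i assume "i \<in> {..<q - 1}"
    then have i: "i < q - 1" by simp
    let ?F = "int (falling (r - 1) (2 * i + 1))"
    have "2 * q - 2 - 2 * i = 2 * (q - 1 - i)" "2 * q - 2 - (2 * i + 1) = 2 * (q - 2 - i) + 1"
      "q - 1 - i - 1 = q - 2 - i" using i by auto
    then have "?c (2 * i) = ?F * (- int (q - 1 - i) * falling_prod s (q - 2 - i))"
      "?c (2 * i + 1) = int (falling (r - 1) (2 * i + 2)) * falling_prod s (q - 2 - i)"
      using arm_diff_even[OF assms(3), of "q - 1 - i"] arm_diff_odd[of s "q - 2 - i"] by simp_all
    moreover have "int (q - 1 - i) = int q - 1 - int i" using i by linarith
    ultimately have "?c (2 * i) + ?c (2 * i + 1) = ?F * (- (int q - 1 - int i) * falling_prod s (q - 2 - i))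
        + ?F * (int r - 2 - 2 * int i) * falling_prod s (q - 2 - i)"
      by (simp only: falling_next[OF assms(2), of i])
    also have "\<dots> = ?F * falling_prod s (q - 2 - i) * (int r - int q - 1 - int i)"
      by algebra
    finally show "?c (2 * i) + ?c (2 * i + 1) = ?F * falling_prod s (q - 2 - i) * (int r - int q - 1 - int i)" .
  qed
  finally show ?thesis .
qed

text \<open>Here the number \<open>2 q - 1\<close> of summands is odd. The missing partner \<open>k = 2 q\<close> would leave an arm
  without edges, whose difference is zero, so it can be added.\<close>

lemma cross_diff_odd:
  assumes "q \<ge> 2" "r \<ge> 1" "s \<ge> 1"
  shows "cross_diff (2 * q + 1) r s
    = (\<Sum>i<q. int (falling (r - 1) (2 * i + 1)) *
        (falling_prod s (q - 1 - i) - (int r - 2 - 2 * int i) * int (q - 1 - i) * falling_prod s (q - 2 - i)))"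
proof -
  let ?c = "\<lambda>k. int (falling (r - 1) (Suc k)) * arm_diff s (2 * q - 1 - k)"
  have "cross_diff (2 * q + 1) r s = (\<Sum>k<2 * q - 1. ?c k)"
    by (simp add: cross_diff_eq_sum)
  also have "\<dots> = (\<Sum>k<Suc (2 * q - 1). ?c k)"
    using arm_diff_even[OF assms(3), of 0] by simp
  also have "Suc (2 * q - 1) = 2 * q" using assms by simp
  also have "(\<Sum>k<2 * q. ?c k) = (\<Sum>i<q. ?c (2 * i) + ?c (2 * i + 1))" by (rule sum_pairs)
  also have "\<dots> = (\<Sum>i<q. int (falling (r - 1) (2 * i + 1)) *
        (falling_prod s (q - 1 - i) - (int r - 2 - 2 * int i) * int (q - 1 - i) * falling_prod s (q - 2 - i)))"
  proof (rule sum.cong[OF refl])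
    fix i assume "i \<in> {..<q}"
    then have i: "i < q" by simp
    let ?F = "int (falling (r - 1) (2 * i + 1))"
    have "2 * q - 1 - 2 * i = 2 * (q - 1 - i) + 1" "2 * q - 1 - (2 * i + 1) = 2 * (q - 1 - i)"
      "q - 1 - i - 1 = q - 2 - i" using i by auto
    then have "?c (2 * i) = ?F * falling_prod s (q - 1 - i)"
      "?c (2 * i + 1) = int (falling (r - 1) (2 * i + 2)) * (- int (q - 1 - i) * falling_prod s (q - 2 - i))"
      using arm_diff_even[OF assms(3), of "q - 1 - i"] arm_diff_odd[of s "q - 1 - i"] by simp_all
    then have "?c (2 * i) + ?c (2 * i + 1) = ?F * falling_prod s (q - 1 - i)
        + ?F * (int r - 2 - 2 * int i) * (- int (q - 1 - i) * falling_prod s (q - 2 - i))"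
      by (simp only: falling_next[OF assms(2), of i])
    also have "\<dots> = ?F * (falling_prod s (q - 1 - i) - (int r - 2 - 2 * int i) * int (q - 1 - i) * falling_prod s (q - 2 - i))"
      by algebra
    finally show "?c (2 * i) + ?c (2 * i + 1)
      = ?F * (falling_prod s (q - 1 - i) - (int r - 2 - 2 * int i) * int (q - 1 - i) * falling_prod s (q - 2 - i))" .
  qed
  finally show ?thesis .
qed

text \<open>In each pair the first function has the larger index, hence dominates; \<open>r * q\<close> bounds the
  coefficient of the second one.\<close>

lemma cross_diff_odd_pos:
  assumes "q \<ge> 2" "r \<ge> 2" "s \<ge> q + r * q + 1"
  shows "cross_diff (2 * q + 1) r s > 0"
proof -
  define R where "R i = falling_prod s (q - 1 - i) - (int r - 2 - 2 * int i) * int (q - 1 - i) * falling_prod s (q - 2 - i)" for i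
  have R: "R i > 0" if "i < q" for i
  proof (cases "i = q - 1")
    case True
    then show ?thesis using assms by (simp add: R_def falling_prod_pos)
  next
    case False
    then have i: "i < q - 1" using that by simp
    have p: "falling_prod s (q - 2 - i) > 0" using assms i by (intro falling_prod_pos) simp
    have "(int r - 2 - 2 * int i) * int (q - 1 - i) \<le> int r * int q"
      by (rule mult_mono) auto
    then have "(int r - 2 - 2 * int i) * int (q - 1 - i) * falling_prod s (q - 2 - i) \<le> int (r * q) * falling_prod s (q - 2 - i)"
      using p by (intro mult_right_mono) auto
    also have "\<dots> < int (r * q + 1) * falling_prod s (q - 2 - i)" using p by (simp add: algebra_simps)
    also have "\<dots> \<le> falling_prod s (q - 1 - i)" using i assms by (intro falling_prod_dominates) auto
    finally show ?thesis by (simp add: R_def)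
  qed
  have "0 < (\<Sum>i<q. int (falling (r - 1) (2 * i + 1)) * R i)"
  proof (rule sum_pos2)
    show "0 \<in> {..<q}" using assms by simp
    show "0 < int (falling (r - 1) (2 * 0 + 1)) * R 0" using R[of 0] assms by simp
    show "0 \<le> int (falling (r - 1) (2 * i + 1)) * R i" if "i \<in> {..<q}" for i
      using R[of i] that by (intro mult_nonneg_nonneg) auto
  qed simp
  then show ?thesis using cross_diff_odd[of q r s] assms by (simp add: R_def del: falling.simps)
qed

text \<open>All factors \<open>r - q - 1 - i\<close> are at most 0. The term \<open>i = 0\<close> is negative for \<open>r \<le> q\<close>; for
  \<open>r = q + 1\<close> it vanishes, but then \<open>q \<ge> 3\<close>, so that the term \<open>i = 1\<close> exists and is negative.\<close>

lemma cross_diff_even_neg: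
  assumes "q \<ge> 2" "r \<ge> 3" "r \<le> q + 1" "(q, r) \<noteq> (2, 3)" "s \<ge> q"
  shows "cross_diff (2 * q) r s < 0"
proof -
  let ?T = "\<lambda>i. int (falling (r - 1) (2 * i + 1)) * falling_prod s (q - 2 - i) * (int r - int q - 1 - int i)"
  define j where "j = (if r \<le> q then 0 else 1 :: nat)"
  \<comment> \<open>the index of a strictly negative term\<close>
  have "0 < (\<Sum>i<q - 1. - ?T i)"
  proof (rule sum_pos2)
    show "j \<in> {..<q - 1}" using assms by (auto simp: j_def)
    have "falling (r - 1) (2 * j + 1) > 0" using assms by (intro falling_pos) (auto simp: j_def)
    moreover have "falling_prod s (q - 2 - j) > 0" using assms by (intro falling_prod_pos) simp
    moreover have "int r - int q - 1 - int j < 0" using assms by (auto simp: j_def)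
    ultimately show "0 < - ?T j" by (simp add: mult_pos_neg del: falling.simps)
    fix i assume "i \<in> {..<q - 1}"
    have "falling_prod s (q - 2 - i) > 0" using assms by (intro falling_prod_pos) simp
    moreover have "int r - int q - 1 - int i \<le> 0" using assms by simp
    ultimately have "?T i \<le> 0" by (intro mult_nonneg_nonpos) auto
    then show "0 \<le> - ?T i" by simp
  qed simp
  then show ?thesis using cross_diff_even[of q r s] assms by (simp add: sum_negf del: falling.simps)
qed

lemma cross_diff_4_3: "s \<ge> 1 \<Longrightarrow> cross_diff 4 3 s = 0"
  using cross_diff_even[of 2 3 s] by simp

text \<open>The term \<open>i = 0\<close> is at least \<open>G = falling_prod s (q - 2)\<close>. The later terms may be negative, but
  \<open>M\<close> times such a function is at most \<open>G\<close>, and \<open>M\<close> exceeds the sum of their coefficients, each of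
  which is bounded by \<open>q\<close> times the falling factorial of \<open>r - 1\<close>.\<close>

lemma cross_diff_even_pos:
  assumes "q \<ge> 2" "r \<ge> q + 2"
  defines "M \<equiv> q * (\<Sum>i<q - 1. falling (r - 1) (2 * i + 1)) + 1"
  assumes "s \<ge> q + M"
  shows "cross_diff (2 * q) r s > 0"
proof -
  let ?F = "\<lambda>i. int (falling (r - 1) (2 * i + 1))"
  let ?T = "\<lambda>i. ?F i * falling_prod s (q - 2 - i) * (int r - int q - 1 - int i)"
  define G where "G = falling_prod s (q - 2)"
  have G: "G > 0" unfolding G_def using assms by (intro falling_prod_pos) simp
  have "(if i = 0 then int M * G else 0) - ?F i * int q * G \<le> int M * ?T i" if i: "i < q - 1" for i
  proof (cases "i = 0")
    case True
    have "1 * G * 1 \<le> ?F 0 * G * (int r - int q - 1)"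
      using assms G by (intro mult_mono) auto
    then have "G \<le> ?T 0" by (simp add: G_def)
    then have "int M * G \<le> int M * ?T 0" by (intro mult_left_mono) simp_all
    moreover have "0 \<le> ?F i * int q * G" using G by simp
    ultimately show ?thesis using True by (simp del: falling.simps)
  next
    case False
    have p: "falling_prod s (q - 2 - i) > 0" using assms by (intro falling_prod_pos) simp
    have d: "int M * falling_prod s (q - 2 - i) \<le> G"
      unfolding G_def using i False assms by (intro falling_prod_dominates) (auto simp: M_def)
    have "0 \<le> int M * ?F i * falling_prod s (q - 2 - i)" using p by (intro mult_nonneg_nonneg) linarith+
    moreover have "- int q \<le> int r - int q - 1 - int i" using i assms(2) by linarith
    ultimately have "int M * ?F i * falling_prod s (q - 2 - i) * (- int q)
        \<le> int M * ?F i * falling_prod s (q - 2 - i) * (int r - int q - 1 - int i)" by (rule mult_left_mono[rotated])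
    moreover have "?F i * int q * (int M * falling_prod s (q - 2 - i)) \<le> ?F i * int q * G"
      using d by (intro mult_left_mono) (simp_all del: falling.simps)
    moreover have "int M * ?F i * falling_prod s (q - 2 - i) * (- int q) = - (?F i * int q * (int M * falling_prod s (q - 2 - i)))"
      by algebra
    ultimately have "- (?F i * int q * G) \<le> int M * ?F i * falling_prod s (q - 2 - i) * (int r - int q - 1 - int i)"
      by linarith
    then show ?thesis using False by (simp add: mult.assoc del: falling.simps)
  qed
  then have "(\<Sum>i<q - 1. (if i = 0 then int M * G else 0) - ?F i * int q * G) \<le> (\<Sum>i<q - 1. int M * ?T i)"
    by (intro sum_mono) auto
  also have "(\<Sum>i<q - 1. int M * ?T i) = int M * cross_diff (2 * q) r s"
    using cross_diff_even[of q r s] assms by (simp add: sum_distrib_left del: falling.simps)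
  also have "(\<Sum>i<q - 1. (if i = 0 then int M * G else 0) - ?F i * int q * G)
      = int M * G - (\<Sum>i<q - 1. ?F i) * int q * G"
    using assms(1) by (simp add: sum_subtractf sum_distrib_right del: falling.simps)
  also have "\<dots> = G" unfolding M_def by (simp add: algebra_simps del: falling.simps)
  finally have "0 < int M * cross_diff (2 * q) r s" using G by simp
  then show ?thesis by (simp add: zero_less_mult_iff)
qed

section \<open>The two isomorphism types of suspensions\<close>

lemma isomorphic_map_graph:
  assumes "inj h"
  shows "isomorphic G (map_graph h G)"
proof -
  have "{h u, h v} \<in> (`) h ` edges G \<longleftrightarrow> {u, v} \<in> edges G" for u v
    using inj_image_mem_iff[of "(`) h" "{u, v}" "edges G"] inj_on_image_Pow[OF assms] by simp
  moreover have "bij_betw h (verts G) (h ` verts G)"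
    using assms by (simp add: bij_betw_def inj_on_subset[OF _ subset_UNIV])
  ultimately show ?thesis
    unfolding isomorphic_def map_graph_def by (intro exI[of _ h]) simp
qed

lemma map_graph_comp: "map_graph h (map_graph k G) = map_graph (h \<circ> k) G"
  by (simp add: map_graph_def image_comp image_image)

lemma map_graph_union: "map_graph h (graph_union G H) = graph_union (map_graph h G) (map_graph h H)"
  by (simp add: map_graph_def graph_union_def image_Un)

lemma map_graph_suspend:
  assumes "inj g"
  shows "map_graph (map_sum f g) (suspend B x H y) = suspend (map_graph f B) (f x) (map_graph g H) (g y)"
proof -
  have *: "(\<lambda>v. if v = g y then Inl (f x) else Inr v) \<circ> g = map_sum f g \<circ> (\<lambda>v. if v = y then Inl x else Inr v)"
    using injD[OF assms] by (auto simp: fun_eq_iff)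
  have "map_sum f g \<circ> Inl = Inl \<circ> f" by (simp add: fun_eq_iff)
  then show ?thesis
    unfolding suspend_eq_graph_union map_graph_union map_graph_comp * by (rule arg_cong)
qed

lemma map_turan2_transpose:
  assumes "x \<in> small_part m \<longleftrightarrow> x' \<in> small_part m" "x < m" "x' < m"
  shows "map_graph (transpose x x') (turan2 m) = turan2 m"
proof -
  let ?f = "transpose x x'"
  have f: "?f ` small_part m = small_part m" "?f ` large_part m = large_part m"
    using assms by (auto simp: small_part_def large_part_def intro!: transpose_image_eq)
  have "(`) ?f ` {{u, v} | u v. u \<in> S \<and> v \<in> L} = {{u, v} | u v. u \<in> ?f ` S \<and> v \<in> ?f ` L}" for S L
    by (auto simp: image_iff) blast+
  with f show ?thesis unfolding map_graph_def turan2_def ugraph.simps image_Un by simp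
qed

lemma map_complete_graph_transpose:
  assumes "y < r" "y' < r"
  shows "map_graph (transpose y y') (complete_graph r) = complete_graph r"
proof -
  let ?f = "transpose y y'"
  have f: "?f ` {..<r} = {..<r}" using assms by simp
  have V: "?f u < r \<longleftrightarrow> u < r" for u using assms by (auto simp: transpose_def)
  have "(`) ?f ` {{u, v} | u v. u < r \<and> v < r \<and> u \<noteq> v} = {{u, v} | u v. u < r \<and> v < r \<and> u \<noteq> v}" (is "_ ` ?E = _")
  proof -
    have sub: "(`) ?f ` ?E \<subseteq> ?E"
    proof (intro subsetI)
      fix e assume "e \<in> (`) ?f ` ?E"
      then obtain u v where uv: "e = {?f u, ?f v}" "u < r" "v < r" "u \<noteq> v" by auto
      moreover have "?f u \<noteq> ?f v" using uv(4) injD[OF inj_transpose[of y y'], of u v] by blast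
      ultimately show "e \<in> ?E" using V by blast
    qed
    then have "(`) ?f ` (`) ?f ` ?E \<subseteq> (`) ?f ` ?E" by (rule image_mono)
    then show ?thesis using sub by (simp add: image_image subset_antisym)
  qed
  with f show ?thesis unfolding map_graph_def complete_graph_def ugraph.simps by simp
qed

text \<open>Exchanging \<open>x\<close> with \<open>x'\<close> is an automorphism of the Turan graph if they are in the same part,
  and exchanging \<open>y\<close> with \<open>y'\<close> is one of the clique; together they carry one suspension to the other.\<close>

lemma isomorphic_suspend_same_part:
  assumes "x \<in> small_part m \<longleftrightarrow> x' \<in> small_part m" "x < m" "x' < m" "y < r" "y' < r"
  shows "isomorphic (suspend (turan2 m) x (complete_graph r) y) (suspend (turan2 m) x' (complete_graph r) y')"
proof -
  let ?f = "transpose x x'" and ?g = "transpose y y'"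
  have "inj (map_sum ?f ?g)" by (intro sum.inj_map inj_transpose)
  from isomorphic_map_graph[OF this, of "suspend (turan2 m) x (complete_graph r) y"] show ?thesis
    unfolding map_graph_suspend[OF inj_transpose] map_turan2_transpose[OF assms(1-3)]
      map_complete_graph_transpose[OF assms(4,5)] transpose_apply_first .
qed

definition T_side :: "nat set \<Rightarrow> nat \<Rightarrow> nat \<Rightarrow> (nat + nat) ugraph set" where
  "T_side P r n = {suspend (turan2 (n + 1 - r)) x (complete_graph r) y | x y. x \<in> P \<and> y < r}"

abbreviation "T_small r n \<equiv> T_side (small_part (n + 1 - r)) r n"
abbreviation "T_large r n \<equiv> T_side (large_part (n + 1 - r)) r n"

lemma T_star_sides: "T_star r n = T_small r n \<union> T_large r n"
  by (auto simp: T_star_def T_side_def turan2_def complete_graph_def)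

lemma quotient_eq_singleton:
  assumes "equiv A R" "z \<in> X" "\<And>G. G \<in> X \<Longrightarrow> (G, z) \<in> R"
  shows "X // R = {z} // R"
proof -
  have "R `` {G} = R `` {z}" if "G \<in> X" for G
    using equiv_class_eq[OF assms(1) assms(3)[OF that]] .
  then have "(\<Union>G\<in>X. {R `` {G}}) = {R `` {z}}" using assms(2) by blast
  then show ?thesis unfolding quotient_def by simp
qed

lemma T_side_quotient:
  assumes P: "P = small_part (n + 1 - r) \<or> P = large_part (n + 1 - r)"
    and x: "x \<in> P" "y < r"
  shows "T_side P r n // iso_rel = {suspend (turan2 (n + 1 - r)) x (complete_graph r) y} // iso_rel"
proof (rule quotient_eq_singleton[OF equiv_iso_rel])
  let ?z = "suspend (turan2 (n + 1 - r)) x (complete_graph r) y"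
  show z: "?z \<in> T_side P r n" using x by (auto simp: T_side_def)
  have simple: "simple_graph G" if "G \<in> T_side P r n" for G
    using that P T_star_sides T_star_simple by blast
  show "(G, ?z) \<in> iso_rel" if G: "G \<in> T_side P r n" for G
  proof -
    from G obtain x' y' where "G = suspend (turan2 (n + 1 - r)) x' (complete_graph r) y'" "x' \<in> P" "y' < r"
      by (auto simp: T_side_def)
    moreover from this x P have "x' \<in> small_part (n + 1 - r) \<longleftrightarrow> x \<in> small_part (n + 1 - r)"
      "x' < n + 1 - r" "x < n + 1 - r"
      by (auto simp: small_part_def large_part_def)
    ultimately show ?thesis
      using simple[OF G] simple[OF z] isomorphic_suspend_same_part x by (simp add: iso_rel_def)
  qed
qed

lemma T_small_quotient:
  "0 < r \<Longrightarrow> r < n \<Longrightarrow> T_small r n // iso_rel = {T_minus r n} // iso_rel"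
  unfolding T_minus_def by (rule T_side_quotient) (use T_minus_in in auto)

lemma T_large_quotient:
  "0 < r \<Longrightarrow> r \<le> n \<Longrightarrow> T_large r n // iso_rel = {T_plus r n} // iso_rel"
  unfolding T_plus_def by (rule T_side_quotient) (use T_plus_in in auto)

section \<open>The maximising suspensions\<close>

lemma num_copies_T_small:
  assumes "t \<ge> 2" "m = n + 1 - r" "G \<in> T_side (small_part m) r n"
  shows "2 * num_copies (path_graph t) G
    = card (paths (turan2 m) t) + card (paths (complete_graph r) t) + 2 * cross_count t r (m div 2) (m - m div 2)"
proof -
  from assms obtain x y where G: "G = suspend (turan2 m) x (complete_graph r) y" "x \<in> small_part m" "y < r"
    by (auto simp: T_side_def)
  then have "x < m" "card (part_of m x) = m div 2" by (auto simp: part_of_def small_part_def)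
  then show ?thesis using G(3) assms(1) num_copies_suspend_turan2[of x m y r t] by (simp add: G(1))
qed

lemma num_copies_T_large:
  assumes "t \<ge> 2" "m = n + 1 - r" "G \<in> T_side (large_part m) r n"
  shows "2 * num_copies (path_graph t) G
    = card (paths (turan2 m) t) + card (paths (complete_graph r) t) + 2 * cross_count t r (m - m div 2) (m div 2)"
proof -
  from assms obtain x y where G: "G = suspend (turan2 m) x (complete_graph r) y" "x \<in> large_part m" "y < r"
    by (auto simp: T_side_def)
  then have "x < m" "card (part_of m x) = m - m div 2"
    by (auto simp: part_of_def small_part_def large_part_def)
  then show ?thesis using G(3) assms(1) num_copies_suspend_turan2[of x m y r t] by (simp add: G(1))
qed

lemma S_family_even:
  assumes "t \<ge> 2" "even (n + 1 - r)"
  shows "S_family t r n = T_star r n"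
proof -
  define m where "m = n + 1 - r"
  have half: "m - m div 2 = m div 2" using assms(2) unfolding m_def[symmetric] by (elim evenE) simp
  have "2 * num_copies (path_graph t) G
      = card (paths (turan2 m) t) + card (paths (complete_graph r) t) + 2 * cross_count t r (m div 2) (m div 2)"
    if "G \<in> T_star r n" for G
    using that num_copies_T_small[OF assms(1) m_def, of G] num_copies_T_large[OF assms(1) m_def, of G] half
    unfolding T_star_sides m_def[symmetric] by auto
  note count = this
  have "num_copies (path_graph t) H \<le> num_copies (path_graph t) G"
    if "G \<in> T_star r n" "H \<in> T_star r n" for G H using count[OF that(1)] count[OF that(2)] by linarith
  then show ?thesis unfolding S_family_def by blast
qed

text \<open>On each side the count is constant, so the comparison of any two members from different sides
  decides which sides survive.\<close>

lemma S_family_odd: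
  assumes t: "t \<ge> 2" and odd: "odd (n + 1 - r)" and r: "0 < r" "r < n"
  defines "d \<equiv> cross_diff t r ((n + 1 - r) div 2)"
  shows "d > 0 \<Longrightarrow> S_family t r n = T_small r n"
    and "d < 0 \<Longrightarrow> S_family t r n = T_large r n"
    and "d = 0 \<Longrightarrow> S_family t r n = T_star r n"
proof -
  let ?N = "num_copies (path_graph t)"
  define m where "m = n + 1 - r"
  have half: "m - m div 2 = m div 2 + 1" using odd unfolding m_def[symmetric] by (elim oddE) simp
  let ?c = "card (paths (turan2 m) t) + card (paths (complete_graph r) t)"
  have small: "2 * ?N G = ?c + 2 * cross_count t r (m div 2) (m div 2 + 1)" if "G \<in> T_small r n" for G
    using num_copies_T_small[OF t m_def] that unfolding m_def[symmetric] half by blast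
  have large: "2 * ?N G = ?c + 2 * cross_count t r (m div 2 + 1) (m div 2)" if "G \<in> T_large r n" for G
    using num_copies_T_large[OF t m_def] that unfolding m_def[symmetric] half by blast
  have SS: "?N G = ?N H" if "G \<in> T_small r n" "H \<in> T_small r n" for G H
    using small[OF that(1)] small[OF that(2)] by simp
  have LL: "?N G = ?N H" if "G \<in> T_large r n" "H \<in> T_large r n" for G H
    using large[OF that(1)] large[OF that(2)] by simp
  have d: "int (?N G) - int (?N H) = d" if "G \<in> T_small r n" "H \<in> T_large r n" for G H
    using small[OF that(1)] large[OF that(2)] unfolding d_def cross_diff_def m_def by linarith
  have ne: "T_minus r n \<in> T_small r n" "T_plus r n \<in> T_large r n"
    unfolding T_side_def T_minus_def T_plus_def using T_minus_in[OF r] T_plus_in[of r n] r by auto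
  have max: "G \<in> S_family t r n \<longleftrightarrow> G \<in> T_star r n \<and> (\<forall>H\<in>T_star r n. ?N H \<le> ?N G)" for G
    by (simp add: S_family_def)
  show "S_family t r n = T_small r n" if "d > 0"
  proof
    show "S_family t r n \<subseteq> T_small r n"
    proof
      fix G assume G: "G \<in> S_family t r n"
      then have "?N (T_minus r n) \<le> ?N G" using ne(1) max T_star_sides by blast
      then have "G \<notin> T_large r n" using d[OF ne(1), of G] that by auto
      then show "G \<in> T_small r n" using G max T_star_sides by blast
    qed
    show "T_small r n \<subseteq> S_family t r n"
    proof
      fix G assume G: "G \<in> T_small r n"
      have "?N H \<le> ?N G" if "H \<in> T_star r n" for H
        using that SS[OF _ G, of H] d[OF G, of H] \<open>d > 0\<close> unfolding T_star_sides by auto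
      then show "G \<in> S_family t r n" using G max T_star_sides by blast
    qed
  qed
  show "S_family t r n = T_large r n" if "d < 0"
  proof
    show "S_family t r n \<subseteq> T_large r n"
    proof
      fix G assume G: "G \<in> S_family t r n"
      then have "?N (T_plus r n) \<le> ?N G" using ne(2) max T_star_sides by blast
      then have "G \<notin> T_small r n" using d[OF _ ne(2), of G] that by auto
      then show "G \<in> T_large r n" using G max T_star_sides by blast
    qed
    show "T_large r n \<subseteq> S_family t r n"
    proof
      fix G assume G: "G \<in> T_large r n"
      have "?N H \<le> ?N G" if "H \<in> T_star r n" for H
        using that LL[OF _ G, of H] d[OF _ G, of H] \<open>d < 0\<close> unfolding T_star_sides by auto
      then show "G \<in> S_family t r n" using G max T_star_sides by blast
    qed
  qed
  show "S_family t r n = T_star r n" if "d = 0"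
  proof -
    have "?N H \<le> ?N G" if GH: "G \<in> T_star r n" "H \<in> T_star r n" for G H
    proof -
      consider "G \<in> T_small r n" "H \<in> T_small r n" | "G \<in> T_large r n" "H \<in> T_large r n"
        | "G \<in> T_small r n" "H \<in> T_large r n" | "G \<in> T_large r n" "H \<in> T_small r n"
        using GH unfolding T_star_sides by blast
      then show ?thesis
      proof cases
        case 1 then show ?thesis using SS[of G H] by simp
      next
        case 2 then show ?thesis using LL[of G H] by simp
      next
        case 3 then show ?thesis using d[of G H] \<open>d = 0\<close> by simp
      next
        case 4 then show ?thesis using d[of H G] \<open>d = 0\<close> by simp
      qed
    qed
    then show ?thesis unfolding S_family_def by blast
  qed
qed

lemma quotient_Un: "(A \<union> B) // R = A // R \<union> B // R"
  by (auto simp: quotient_def)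

theorem proposition1p2:
  fixes t r :: nat
  assumes "t \<ge> 4" and "r \<ge> 3"
  shows "(\<forall>n\<ge>r. even (n + 1 - r) \<longrightarrow> S_family t r n // iso_rel = T_star r n // iso_rel) \<and>
    (\<exists>N. \<forall>n\<ge>N. odd (n + 1 - r) \<longrightarrow>
      (odd t \<longrightarrow> S_family t r n // iso_rel = {T_minus r n} // iso_rel) \<and>
      (\<forall>q. t = 2 * q \<longrightarrow>
        (r \<le> q + 1 \<and> (t, r) \<noteq> (4, 3) \<longrightarrow>
           S_family t r n // iso_rel = {T_plus r n} // iso_rel) \<and>
        ((t, r) = (4, 3) \<longrightarrow>
           S_family t r n // iso_rel = {T_plus r n, T_minus r n} // iso_rel) \<and>
        (r \<ge> q + 2 \<longrightarrow>
           S_family t r n // iso_rel = {T_minus r n} // iso_rel)))"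
proof (intro conjI)
  show "\<forall>n\<ge>r. even (n + 1 - r) \<longrightarrow> S_family t r n // iso_rel = T_star r n // iso_rel"
    using S_family_even[of t _ r] assms by simp
next
  define h where "h = t div 2"
  \<comment> \<open>large enough for all three comparisons of the two sides at once\<close>
  define K where "K = h + r * h + 1 + (h * (\<Sum>i<h - 1. falling (r - 1) (2 * i + 1)) + 1)"
  have h: "h \<ge> 2" using assms by (simp add: h_def)
  show "\<exists>N. \<forall>n\<ge>N. odd (n + 1 - r) \<longrightarrow>
      (odd t \<longrightarrow> S_family t r n // iso_rel = {T_minus r n} // iso_rel) \<and>
      (\<forall>q. t = 2 * q \<longrightarrow>
        (r \<le> q + 1 \<and> (t, r) \<noteq> (4, 3) \<longrightarrow>
           S_family t r n // iso_rel = {T_plus r n} // iso_rel) \<and>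
        ((t, r) = (4, 3) \<longrightarrow>
           S_family t r n // iso_rel = {T_plus r n, T_minus r n} // iso_rel) \<and>
        (r \<ge> q + 2 \<longrightarrow>
           S_family t r n // iso_rel = {T_minus r n} // iso_rel))"
  proof (intro exI[of _ "r + 2 * K"] allI impI conjI)
    fix n assume n: "r + 2 * K \<le> n" and odd: "odd (n + 1 - r)"
    let ?s = "(n + 1 - r) div 2"
    have s: "?s \<ge> K" using n by simp
    have r: "0 < r" "r < n" using n assms by (auto simp: K_def)
    have t: "t \<ge> 2" using assms by simp
    note S = S_family_odd[OF t odd r]
    note minus = T_small_quotient[OF r] and plus = T_large_quotient[OF r(1) less_imp_le[OF r(2)]]
    show "S_family t r n // iso_rel = {T_minus r n} // iso_rel" if "odd t"
    proof -
      have "t = 2 * h + 1" using that by (simp add: h_def)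
      then have "cross_diff t r ?s > 0"
        using cross_diff_odd_pos[of h r ?s] h s assms by (simp add: K_def)
      then show ?thesis using S(1) minus by simp
    qed
    fix q assume q: "t = 2 * q"
    then have hq: "h = q" by (simp add: h_def)
    show "S_family t r n // iso_rel = {T_plus r n} // iso_rel" if "r \<le> q + 1 \<and> (t, r) \<noteq> (4, 3)"
    proof -
      have "cross_diff t r ?s < 0"
        using cross_diff_even_neg[of q r ?s] h s assms that q hq by (auto simp: K_def)
      then show ?thesis using S(2) plus by simp
    qed
    show "S_family t r n // iso_rel = {T_plus r n, T_minus r n} // iso_rel" if "(t, r) = (4, 3)"
    proof -
      have "cross_diff t r ?s = 0" using cross_diff_4_3[of ?s] s that by (simp add: K_def)
      then have "S_family t r n // iso_rel = {T_plus r n} // iso_rel \<union> {T_minus r n} // iso_rel"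
        using S(3) minus plus by (simp add: T_star_sides quotient_Un Un_commute)
      then show ?thesis by (simp add: quotient_Un[symmetric] insert_commute)
    qed
    show "S_family t r n // iso_rel = {T_minus r n} // iso_rel" if "r \<ge> q + 2"
    proof -
      have "cross_diff t r ?s > 0"
        using cross_diff_even_pos[of q r ?s] h s that q hq by (simp add: K_def)
      then show ?thesis using S(1) minus by simp
    qed
  qed
qed

end
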